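(* Let $M$ be a Riemannian manifold, $\mathcal{F}$ a foliation on $M$, $p>1$, and assume there exists an extremal function $f_0$ for the $p$-modulus of $\mathcal{F}$. Assume $\mathrm{ess\,inf}_M f_0>0$. Then $$\int_M f_0^{p-1}\varphi\,d\mu_M=\int_M f_0^{p}\,\hat\varphi\,d\mu_M$$ for any function $\varphi\in L^p(M)$ such that $\mathrm{ess\,sup}_M|\varphi|<\infty$ and $\mathrm{ess\,sup}_M|\hat\varphi|<\infty$.
   Context: $\mu_M$ and $\mu_L$ denote the Lebesgue (Riemannian volume) measures on $M$ and on a leaf $L\in\mathcal{F}$; $L_x$ is the leaf through $x\in M$. A property holds for almost every $L\in\mathcal{F}$ if the union of the leaves for which it fails has $\mu_M$-measure zero. $\mathrm{adm}_p(\mathcal{F})$ is the family of all nonnegative $f\in L^p(M)$ such that $\int_L f\,d\mu_L\geq 1$ for almost every $L\in\mathcal{F}$; $\mathrm{mod}_p(\mathcal{F})=\inf_{f\in\mathrm{adm}_p(\mathcal{F})}\|f\|_p$ if $\mathrm{adm}_p(\mathcal{F})\neq\emptyset$ and $\mathrm{mod}_p(\mathcal{F})=\infty$ otherwise. A function $f_0\in\mathrm{adm}_p(\mathcal{F})$ is extremal for the $p$-modulus of $\mathcal{F}$ if $\mathrm{mod}_p(\mathcal{F})=\|f_0\|_p$. For $\varphi\in L^p(M)$, $\hat\varphi(x)=\int_{L_x}\varphi\,d\mu_{L_x}$, $x\in M$; when an extremal function exists, every $\varphi\in L^p(M)$ belongs to $L^1(L)$ for almost every leaf $L$, so $\hat\varphi$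 is well defined $\mu_M$-almost everywhere. *)

theory Defs
  imports "HOL-Analysis.Analysis"
begin

section \<open>Smooth manifolds and Riemannian metrics\<close>

primrec Ck_on :: "nat \<Rightarrow> 'a::real_normed_vector set \<Rightarrow> ('a \<Rightarrow> 'b::real_normed_vector) \<Rightarrow> bool" where
  "Ck_on 0 S f \<longleftrightarrow> continuous_on S f"
| "Ck_on (Suc k) S f \<longleftrightarrow>
     (\<forall>x\<in>S. f differentiable (at x)) \<and> (\<forall>v. Ck_on k S (\<lambda>x. frechet_derivative f (at x) v))"

definition smooth_on :: "'a::real_normed_vector set \<Rightarrow> ('a \<Rightarrow> 'b::real_normed_vector) \<Rightarrow> bool" where
  "smooth_on S f \<longleftrightarrow> (\<forall>k. Ck_on k S f)"

text \<open>A chart is a pair of its domain and its coordinate map; values of the coordinate map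
  outside the domain are irrelevant.  The manifold itself is a whole type \<open>'m\<close>, and
  its dimension is that of the model space \<open>'e\<close>.\<close>

type_synonym ('m, 'e) chart = "'m set \<times> ('m \<Rightarrow> 'e)"

abbreviation chart_dom :: "('m, 'e) chart \<Rightarrow> 'm set" where
  "chart_dom c \<equiv> fst c"

abbreviation coord :: "('m, 'e) chart \<Rightarrow> 'm \<Rightarrow> 'e" where
  "coord c \<equiv> snd c"

abbreviation chart_inv :: "('m, 'e) chart \<Rightarrow> 'e \<Rightarrow> 'm" where
  "chart_inv c \<equiv> inv_into (chart_dom c) (coord c)"

definition smooth_atlas ::
  "('m::{second_countable_topology, t2_space}, 'e::euclidean_space) chart set \<Rightarrow> bool" where
  "smooth_atlas A \<longleftrightarrow>
     (\<Union>c\<in>A. chart_dom c) = UNIV \<and>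
     (\<forall>c\<in>A. open (chart_dom c) \<and> open (coord c ` chart_dom c) \<and>
        homeomorphism (chart_dom c) (coord c ` chart_dom c) (coord c) (chart_inv c)) \<and>
     (\<forall>c\<in>A. \<forall>c'\<in>A.
        smooth_on (coord c ` (chart_dom c \<inter> chart_dom c')) (coord c' \<circ> chart_inv c))"

text \<open>The metric is given by its coordinate expressions: \<open>g c x u v\<close> is the inner product
  of the tangent vectors at \<open>x\<close> with components \<open>u\<close> and \<open>v\<close> in the chart \<open>c\<close>.
  The last clause is the transformation law of a covariant 2-tensor.\<close>

type_synonym ('m, 'e) metric_coords = "('m, 'e) chart \<Rightarrow> 'm \<Rightarrow> 'e \<Rightarrow> 'e \<Rightarrow> real"

definition riemannian_metric ::
  "('m::{second_countable_topology, t2_space}, 'e::euclidean_space) chart set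
     \<Rightarrow> ('m, 'e) metric_coords \<Rightarrow> bool" where
  "riemannian_metric A g \<longleftrightarrow>
     (\<forall>c\<in>A. \<forall>x\<in>chart_dom c.
        bilinear (g c x) \<and> (\<forall>u v. g c x u v = g c x v u) \<and> (\<forall>u. u \<noteq> 0 \<longrightarrow> g c x u u > 0)) \<and>
     (\<forall>c\<in>A. \<forall>u v. smooth_on (coord c ` chart_dom c) (\<lambda>z. g c (chart_inv c z) u v)) \<and>
     (\<forall>c\<in>A. \<forall>c'\<in>A. \<forall>x\<in>chart_dom c \<inter> chart_dom c'. \<forall>u v.
        (let D = frechet_derivative (coord c' \<circ> chart_inv c) (at (coord c x))
         in g c x u v = g c' x (D u) (D v)))"

definition riemannian_manifold ::
  "('m::{second_countable_topology, t2_space}, 'e::euclidean_space) chart set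
     \<Rightarrow> ('m, 'e) metric_coords \<Rightarrow> bool" where
  "riemannian_manifold A g \<longleftrightarrow> smooth_atlas A \<and> riemannian_metric A g"


section \<open>Foliations\<close>

text \<open>The set \<open>B\<close> of coordinate directions spans the tangent directions of the leaves, so the
  leaves have dimension \<open>card B\<close>.  In foliated charts (whose images are open boxes) the plaques are
  the slices on which the remaining coordinates are constant.\<close>

definition plaque :: "'e::euclidean_space set \<Rightarrow> ('m, 'e) chart \<Rightarrow> 'm \<Rightarrow> 'm set" where
  "plaque B c x = {y \<in> chart_dom c. \<forall>b\<in>Basis - B. coord c y \<bullet> b = coord c x \<bullet> b}"

text \<open>The last clause says that coordinate changes between foliated charts are locally of the form
  \<open>(s, t) \<mapsto> (h\<^sub>1(s, t), h\<^sub>2(t))\<close>, with \<open>s\<close> the coordinates in the directions \<open>B\<close> and \<open>t\<close> the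
  transverse ones.\<close>

definition foliated_atlas ::
  "('m::{second_countable_topology, t2_space}, 'e::euclidean_space) chart set
     \<Rightarrow> 'e set \<Rightarrow> ('m, 'e) chart set \<Rightarrow> bool" where
  "foliated_atlas A B F \<longleftrightarrow>
     B \<subseteq> Basis \<and> F \<subseteq> A \<and> (\<Union>c\<in>F. chart_dom c) = UNIV \<and>
     (\<forall>c\<in>F. \<exists>l u. coord c ` chart_dom c = box l u) \<and>
     (\<forall>c\<in>F. \<forall>c'\<in>F. \<forall>x\<in>chart_dom c \<inter> chart_dom c'.
        \<exists>W. open W \<and> x \<in> W \<and> W \<subseteq> chart_dom c \<inter> chart_dom c' \<and>
            (\<forall>y\<in>W. \<forall>z\<in>W. z \<in> plaque B c y \<longrightarrow> z \<in> plaque B c' y))"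

text \<open>Two points are on the same leaf iff they are joined by a finite chain of plaques.\<close>

definition leaf :: "'e::euclidean_space set \<Rightarrow> ('m, 'e) chart set \<Rightarrow> 'm \<Rightarrow> 'm set" where
  "leaf B F x = {y. (\<lambda>v w. \<exists>c\<in>F. v \<in> chart_dom c \<and> w \<in> plaque B c v)\<^sup>*\<^sup>* x y}"

definition leaves :: "'e::euclidean_space set \<Rightarrow> ('m, 'e) chart set \<Rightarrow> 'm set set" where
  "leaves B F = range (leaf B F)"


section \<open>Riemannian volume on the manifold and on the leaves\<close>

text \<open>The determinant of the matrix \<open>(h b b')\<close> indexed by the finite set \<open>D\<close>.\<close>

definition gram_det :: "'e set \<Rightarrow> ('e \<Rightarrow> 'e \<Rightarrow> real) \<Rightarrow> real" where
  "gram_det D h = (\<Sum>p | p permutes D. of_int (sign p) * (\<Prod>b\<in>D. h b (p b)))"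

text \<open>Lebesgue measure of the affine coordinate subspace through \<open>z\<close> with directions \<open>D\<close>, viewed as
  a Borel measure on the whole space; for \<open>D = Basis\<close> this is \<open>lborel\<close>, and for \<open>D = {}\<close> the unit
  mass at \<open>z\<close>.\<close>

definition slice_lborel :: "'e::euclidean_space set \<Rightarrow> 'e \<Rightarrow> 'e measure" where
  "slice_lborel D z =
     distr (\<Pi>\<^sub>M b\<in>D. lborel) borel
       (\<lambda>u. (\<Sum>b\<in>D. u b *\<^sub>R b) + (\<Sum>b\<in>Basis - D. (z \<bullet> b) *\<^sub>R b))"

text \<open>The coordinate formula for the volume: the integral of \<open>sqrt (det (g\<^sub>i\<^sub>j))\<close>, with \<open>i, j\<close>
  ranging over \<open>D\<close>, over the part of the coordinate image of \<open>S\<close> in the slice through \<open>z\<close>.\<close>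

definition coord_volume ::
  "('m, 'e::euclidean_space) metric_coords \<Rightarrow> ('m, 'e) chart \<Rightarrow> 'e set \<Rightarrow> 'e \<Rightarrow> 'm set \<Rightarrow> ennreal" where
  "coord_volume g c D z S =
     (\<integral>\<^sup>+ w\<in>coord c ` S. ennreal (sqrt (gram_det D (g c (chart_inv c w)))) \<partial>slice_lborel D z)"

text \<open>The Riemannian volume is the unique Borel measure given by the coordinate formula in every
  chart, extended to its completion (Lebesgue measurable sets).  Existence is the change of
  variables formula, uniqueness holds because countably many charts cover the manifold.
  For \<open>D = Basis\<close> the base point of the slice is immaterial.\<close>

definition riemannian_volume ::
  "('m::{second_countable_topology, t2_space}, 'e::euclidean_space) chart set
     \<Rightarrow> ('m, 'e) metric_coords \<Rightarrow> 'm measure \<Rightarrow> bool" where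
  "riemannian_volume A g \<mu> \<longleftrightarrow>
     (\<exists>\<beta>. \<mu> = completion \<beta> \<and> sets \<beta> = sets borel \<and>
        (\<forall>c\<in>A. \<forall>S\<in>sets borel. S \<subseteq> chart_dom c \<longrightarrow> emeasure \<beta> S = coord_volume g c Basis 0 S))"

text \<open>Likewise for the metric induced on a leaf \<open>L\<close>, for which the plaques contained in \<open>L\<close> with the
  coordinates in the directions \<open>B\<close> form an atlas.  Since \<open>L\<close> is a countable union of plaques, each
  of them embedded in the manifold and open in \<open>L\<close>, the Borel sets of the leaf topology
  are the traces on \<open>L\<close> of the Borel sets of the manifold.\<close>

definition leaf_volume ::
  "('m::{second_countable_topology, t2_space}, 'e::euclidean_space) metric_coords
     \<Rightarrow> 'e set \<Rightarrow> ('m, 'e) chart set \<Rightarrow> 'm set \<Rightarrow> 'm measure \<Rightarrow> bool" where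
  "leaf_volume g B F L \<nu> \<longleftrightarrow>
     (\<exists>\<beta>. \<nu> = completion \<beta> \<and> sets \<beta> = sets (restrict_space borel L) \<and>
        (\<forall>c\<in>F. \<forall>x\<in>chart_dom c \<inter> L. \<forall>S\<in>sets borel. S \<subseteq> plaque B c x \<longrightarrow>
            emeasure \<beta> S = coord_volume g c B (coord c x) S))"


section \<open>The modulus of a foliation\<close>

text \<open>In this section \<open>\<L>\<close> is the set of leaves, \<open>\<mu>\<close> the volume of the manifold, and \<open>\<nu> L\<close> the volume
  of the leaf \<open>L\<close>.\<close>

definition almost_every_leaf :: "'m measure \<Rightarrow> 'm set set \<Rightarrow> ('m set \<Rightarrow> bool) \<Rightarrow> bool" where
  "almost_every_leaf \<mu> \<L> P \<longleftrightarrow> \<Union>{L \<in> \<L>. \<not> P L} \<in> null_sets \<mu>"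

definition Lp :: "real \<Rightarrow> 'a measure \<Rightarrow> ('a \<Rightarrow> real) set" where
  "Lp p M = {f \<in> borel_measurable M. integrable M (\<lambda>x. \<bar>f x\<bar> powr p)}"

definition Lp_norm :: "real \<Rightarrow> 'a measure \<Rightarrow> ('a \<Rightarrow> real) \<Rightarrow> real" where
  "Lp_norm p M f = (\<integral>x. \<bar>f x\<bar> powr p \<partial>M) powr (1 / p)"

text \<open>Elements of \<open>Lp\<close> stand for their classes modulo null sets, hence nonnegativity is required
  only almost everywhere.  The leaf integrals may be infinite.\<close>

definition adm ::
  "real \<Rightarrow> 'm measure \<Rightarrow> 'm set set \<Rightarrow> ('m set \<Rightarrow> 'm measure) \<Rightarrow> ('m \<Rightarrow> real) set" where
  "adm p \<mu> \<L> \<nu> =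
     {f \<in> Lp p \<mu>. (AE x in \<mu>. 0 \<le> f x) \<and>
        almost_every_leaf \<mu> \<L>
          (\<lambda>L. f \<in> borel_measurable (\<nu> L) \<and> 1 \<le> (\<integral>\<^sup>+ x. ennreal (f x) \<partial>\<nu> L))}"

text \<open>The infimum over the empty family is \<open>\<infinity>\<close>.\<close>

definition modulus ::
  "real \<Rightarrow> 'm measure \<Rightarrow> 'm set set \<Rightarrow> ('m set \<Rightarrow> 'm measure) \<Rightarrow> ennreal" where
  "modulus p \<mu> \<L> \<nu> = (INF f\<in>adm p \<mu> \<L> \<nu>. ennreal (Lp_norm p \<mu> f))"

definition extremal ::
  "real \<Rightarrow> 'm measure \<Rightarrow> 'm set set \<Rightarrow> ('m set \<Rightarrow> 'm measure) \<Rightarrow> ('m \<Rightarrow> real) \<Rightarrow> bool" where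
  "extremal p \<mu> \<L> \<nu> f \<longleftrightarrow>
     f \<in> adm p \<mu> \<L> \<nu> \<and> modulus p \<mu> \<L> \<nu> = ennreal (Lp_norm p \<mu> f)"

definition leaf_integral ::
  "'e::euclidean_space set \<Rightarrow> ('m, 'e) chart set \<Rightarrow> ('m set \<Rightarrow> 'm measure) \<Rightarrow> ('m \<Rightarrow> real) \<Rightarrow> 'm \<Rightarrow> real"
  where "leaf_integral B F \<nu> \<phi> x = (\<integral>y. \<phi> y \<partial>\<nu> (leaf B F x))"

text \<open>For measurable functions \<open>ess_sup\<close> is \<open>esssup\<close> of HOL-Probability.  The latter is
  \<open>\<infinity>\<close> by convention for nonmeasurable functions, so that a bound on it would tacitly
  assume the measurability of leaf integrals.\<close>

definition ess_sup :: "'a measure \<Rightarrow> ('a \<Rightarrow> ereal) \<Rightarrow> ereal" where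
  "ess_sup M f = Limsup (ae_filter M) f"

definition ess_inf :: "'a measure \<Rightarrow> ('a \<Rightarrow> ereal) \<Rightarrow> ereal" where
  "ess_inf M f = Liminf (ae_filter M) f"

end

theory Submission
  imports Defs
begin

text \<open>
  For small \<open>t > 0\<close> the function \<open>f\<^sub>t = (f\<^sub>0 + t \<phi>) / (1 + t \<phi>')\<close>, with \<open>\<phi>'\<close> the leaf integral
  of \<open>\<phi>\<close>, is admissible because \<open>\<phi>'\<close> is constant on leaves. Minimality of \<open>f\<^sub>0\<close> and convexity of
  the \<open>p\<close>-th power give \<open>0 \<le> \<integral> f\<^sub>t\<^sup>p - f\<^sub>0\<^sup>p \<le> p t \<integral> f\<^sub>t\<^sup>p\<^sup>-\<^sup>1 (\<phi> - f\<^sub>0 \<phi>') / (1 + t \<phi>')\<close>; dividing by \<open>t\<close>,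
  letting \<open>t \<rightarrow> 0\<close>, and doing the same for \<open>-\<phi>\<close> yields the claim.

  This needs \<open>\<phi>'\<close> to be measurable. Countably many Borel maps, each a composition of moves within
  plaques, reach every plaque of the leaf of a point, so the leaf volume of a Borel set is a countable
  sum of plaque volumes that depend measurably on the point.

  That null sets of the manifold meet almost every leaf in a null set, and that \<open>\<phi>\<close> is integrable on
  almost every leaf, both follow from extremality: if a saturated set \<open>E\<close> carries functions of
  arbitrarily small norm whose leaf integrals are at least 1, then replacing \<open>f\<^sub>0\<close> on \<open>E\<close> by these
  shows that \<open>f\<^sub>0\<close> vanishes almost everywhere on \<open>E\<close>.\<close>

section \<open>Moving along plaques\<close>

lemma plaque_refl: "x \<in> chart_dom c \<Longrightarrow> x \<in> plaque B c x"
  by (simp add: plaque_def)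

lemma plaque_dom: "y \<in> plaque B c x \<Longrightarrow> y \<in> chart_dom c"
  by (simp add: plaque_def)

lemma plaque_eq: "y \<in> plaque B c x \<Longrightarrow> plaque B c y = plaque B c x"
  by (auto simp: plaque_def)

lemma leaf_refl: "x \<in> leaf B F x"
  by (simp add: leaf_def)

lemma leaf_trans: "y \<in> leaf B F x \<Longrightarrow> z \<in> leaf B F y \<Longrightarrow> z \<in> leaf B F x"
  by (auto simp: leaf_def)

lemma leaf_sym: "y \<in> leaf B F x \<Longrightarrow> x \<in> leaf B F y"
proof -
  assume "y \<in> leaf B F x"
  then show ?thesis
    unfolding leaf_def mem_Collect_eq
    by (rule sympD[OF symp_rtranclp, rotated]) (auto intro!: sympI simp: plaque_def)
qed

lemma leaf_eq:
  assumes "y \<in> leaf B F x"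
  shows "leaf B F y = leaf B F x"
proof (intro equalityI subsetI)
  show "z \<in> leaf B F x" if "z \<in> leaf B F y" for z
    using assms that by (rule leaf_trans)
  show "z \<in> leaf B F y" if "z \<in> leaf B F x" for z
    using leaf_sym[OF assms] that by (rule leaf_trans)
qed

lemma plaque_subset_leaf: "c \<in> F \<Longrightarrow> x \<in> chart_dom c \<Longrightarrow> plaque B c x \<subseteq> leaf B F x"
  by (auto simp: leaf_def)

definition slice_point :: "'e::euclidean_space set \<Rightarrow> ('e \<Rightarrow> real) \<Rightarrow> 'e \<Rightarrow> 'e" where
  "slice_point B u z = (\<Sum>b\<in>B. u b *\<^sub>R b) + (\<Sum>b\<in>Basis - B. (z \<bullet> b) *\<^sub>R b)"

lemma slice_point_inner:
  assumes "B \<subseteq> Basis" "b \<in> Basis"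
  shows "slice_point B u z \<bullet> b = (if b \<in> B then u b else z \<bullet> b)"
proof -
  have "finite B" using assms(1) finite_Basis finite_subset by blast
  have 1: "(\<Sum>b'\<in>B. u b' *\<^sub>R b') \<bullet> b = (\<Sum>b'\<in>B. if b' = b then u b else 0)"
    unfolding inner_sum_left using assms by (intro sum.cong) (auto simp: inner_Basis)
  have 2: "(\<Sum>b'\<in>Basis - B. (z \<bullet> b') *\<^sub>R b') \<bullet> b = (\<Sum>b'\<in>Basis - B. if b' = b then z \<bullet> b else 0)"
    unfolding inner_sum_left using assms by (intro sum.cong) (auto simp: inner_Basis)
  show ?thesis
    using assms \<open>finite B\<close> unfolding slice_point_def inner_add_left 1 2 by auto
qed

lemma slice_point_self: "B \<subseteq> Basis \<Longrightarrow> slice_point B ((\<bullet>) z) z = z"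
  by (rule euclidean_eqI) (simp add: slice_point_inner)

lemma continuous_slice_point:
  "(\<And>b. continuous_on S (\<lambda>x. f x b)) \<Longrightarrow> continuous_on S h \<Longrightarrow>
    continuous_on S (\<lambda>x. slice_point B (f x) (h x))"
  unfolding slice_point_def by (intro continuous_intros)

definition plaque_step :: "'e::euclidean_space set \<Rightarrow> ('m, 'e) chart \<Rightarrow> 'e \<Rightarrow> 'm \<Rightarrow> 'm" where
  "plaque_step B c q x =
     (if x \<in> chart_dom c \<and> slice_point B ((\<bullet>) q) (coord c x) \<in> coord c ` chart_dom c
      then chart_inv c (slice_point B ((\<bullet>) q) (coord c x)) else x)"

abbreviation walk :: "'e::euclidean_space set \<Rightarrow> (('m, 'e) chart \<times> 'e) list \<Rightarrow> 'm \<Rightarrow> 'm" where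
  "walk B \<equiv> fold (\<lambda>(c, q). plaque_step B c q)"

locale foliated_manifold =
  fixes A F :: "('m::{second_countable_topology, t2_space}, 'e::euclidean_space) chart set"
    and g :: "('m, 'e) metric_coords"
    and B :: "'e set"
  assumes manifold: "riemannian_manifold A g"
    and foliated: "foliated_atlas A B F"
begin

lemma B_Basis: "B \<subseteq> Basis" and F_atlas: "F \<subseteq> A" and F_cover: "(\<Union>c\<in>F. chart_dom c) = UNIV"
  and chart_box: "c \<in> F \<Longrightarrow> \<exists>l u. coord c ` chart_dom c = box l u"
  using foliated unfolding foliated_atlas_def by blast+

lemma finite_B: "finite B"
  using B_Basis finite_Basis finite_subset by blast

lemma
  assumes "c \<in> F"
  shows open_dom: "open (chart_dom c)"
    and open_image: "open (coord c ` chart_dom c)"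
    and chart_homeomorphism:
      "homeomorphism (chart_dom c) (coord c ` chart_dom c) (coord c) (chart_inv c)"
  using assms F_atlas manifold unfolding riemannian_manifold_def smooth_atlas_def by blast+

lemma chart_inv_coord: "c \<in> F \<Longrightarrow> x \<in> chart_dom c \<Longrightarrow> chart_inv c (coord c x) = x"
  using homeomorphism_apply1[OF chart_homeomorphism] .

lemma coord_chart_inv: "w \<in> coord c ` chart_dom c \<Longrightarrow> coord c (chart_inv c w) = w"
  by (rule f_inv_into_f)

lemma chart_inv_dom: "w \<in> coord c ` chart_dom c \<Longrightarrow> chart_inv c w \<in> chart_dom c"
  by (rule inv_into_into)

lemma coord_image_iff:
  assumes "c \<in> F" "S \<subseteq> chart_dom c"
  shows "w \<in> coord c ` S \<longleftrightarrow> w \<in> coord c ` chart_dom c \<and> chart_inv c w \<in> S"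
proof
  assume "w \<in> coord c ` S"
  then obtain x where x: "x \<in> S" "w = coord c x" by (rule imageE)
  have "x \<in> chart_dom c" using assms(2) x(1) by (rule subsetD)
  then show "w \<in> coord c ` chart_dom c \<and> chart_inv c w \<in> S"
    using x chart_inv_coord[OF assms(1)] by simp
next
  assume "w \<in> coord c ` chart_dom c \<and> chart_inv c w \<in> S"
  then show "w \<in> coord c ` S"
    using coord_chart_inv[of w c] by (metis imageI)
qed

lemma continuous_coord: "c \<in> F \<Longrightarrow> continuous_on (chart_dom c) (coord c)"
  and continuous_chart_inv: "c \<in> F \<Longrightarrow> continuous_on (coord c ` chart_dom c) (chart_inv c)"
  using chart_homeomorphism homeomorphism_def by blast+

lemma plaque_overlap:
  assumes "c \<in> F" "c' \<in> F" "x \<in> chart_dom c" "x \<in> chart_dom c'"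
  obtains W where "open W" "x \<in> W" "W \<subseteq> chart_dom c \<inter> chart_dom c'"
    "\<And>y z. y \<in> W \<Longrightarrow> z \<in> W \<Longrightarrow> z \<in> plaque B c y \<Longrightarrow> z \<in> plaque B c' y"
proof -
  have "\<exists>W. open W \<and> x \<in> W \<and> W \<subseteq> chart_dom c \<inter> chart_dom c' \<and>
      (\<forall>y\<in>W. \<forall>z\<in>W. z \<in> plaque B c y \<longrightarrow> z \<in> plaque B c' y)"
    using foliated assms unfolding foliated_atlas_def by simp
  then show ?thesis using that by blast
qed

lemma connected_plaque:
  assumes "c \<in> F"
  shows "connected (plaque B c x)"
proof -
  obtain l u where lu: "coord c ` chart_dom c = box l u"
    using chart_box[OF assms] by blast
  define S where "S = box l u \<inter> (\<Inter>b\<in>Basis - B. {w. b \<bullet> w = coord c x \<bullet> b})"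
  have "convex S"
    unfolding S_def by (intro convex_Int convex_box convex_INT convex_hyperplane)
  then have "connected S" by (rule convex_connected)
  moreover have "plaque B c x = chart_inv c ` S"
  proof (intro equalityI subsetI)
    fix y assume y: "y \<in> plaque B c x"
    then have "y = chart_inv c (coord c y)" "coord c y \<in> S"
      using chart_inv_coord[OF assms] lu unfolding plaque_def S_def by (auto simp: inner_commute)
    then show "y \<in> chart_inv c ` S" by blast
  next
    fix y assume "y \<in> chart_inv c ` S"
    then obtain w where w: "w \<in> S" "y = chart_inv c w" by blast
    then have "w \<in> coord c ` chart_dom c" unfolding S_def lu by blast
    then show "y \<in> plaque B c x"
      using w coord_chart_inv[of w c] chart_inv_dom[of w c] unfolding plaque_def S_def
      by (simp add: inner_commute)
  qed
  moreover have "continuous_on S (chart_inv c)"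
    by (rule continuous_on_subset[OF continuous_chart_inv[OF assms]]) (simp add: S_def lu)
  ultimately show ?thesis by (simp add: connected_continuous_image)
qed

lemma leaf_subatlas:
  assumes "F' \<subseteq> F" "(\<Union>c\<in>F'. chart_dom c) = UNIV"
  shows "leaf B F' x = leaf B F x"
proof (intro equalityI subsetI)
  fix y assume "y \<in> leaf B F' x"
  then show "y \<in> leaf B F x"
    unfolding leaf_def mem_Collect_eq using assms(1)
    by (elim rtranclp_mono[THEN predicate2D, rotated]) blast
next
  have plaque: "w \<in> leaf B F' v" if c: "c \<in> F" and v: "v \<in> chart_dom c" and w: "w \<in> plaque B c v"
    for c v w
  proof (rule connected_equivalence_relation[OF connected_plaque[OF c, of v], where R = "\<lambda>a b. b \<in> leaf B F' a"])
    show "v \<in> plaque B c v" "w \<in> plaque B c v"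
      using v w by (auto intro: plaque_refl)
    show "b \<in> leaf B F' a" if "a \<in> leaf B F' b" for a b
      using that by (rule leaf_sym)
    show "d \<in> leaf B F' a" if "b \<in> leaf B F' a" "d \<in> leaf B F' b" for a b d
      using that by (rule leaf_trans)
    fix a assume a: "a \<in> plaque B c v"
    obtain c' where c': "c' \<in> F'" "a \<in> chart_dom c'" using assms(2) by (metis UNIV_I UN_iff)
    obtain W where W: "open W" "a \<in> W" "W \<subseteq> chart_dom c \<inter> chart_dom c'"
      "\<And>y z. y \<in> W \<Longrightarrow> z \<in> W \<Longrightarrow> z \<in> plaque B c y \<Longrightarrow> z \<in> plaque B c' y"
      using plaque_overlap[OF c subsetD[OF assms(1) c'(1)] plaque_dom[OF a] c'(2)] by metis
    show "\<exists>T. openin (top_of_set (plaque B c v)) T \<and> a \<in> T \<and> (\<forall>x\<in>T. x \<in> leaf B F' a)"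
    proof (intro exI conjI ballI)
      show "openin (top_of_set (plaque B c v)) (plaque B c v \<inter> W)"
        using W(1) by (rule openin_open_Int)
      show "a \<in> plaque B c v \<inter> W" using a W(2) by blast
      fix x assume "x \<in> plaque B c v \<inter> W"
      then have "x \<in> plaque B c' a"
        using W(2) plaque_eq[OF a] by (intro W(4)) auto
      then show "x \<in> leaf B F' a"
        using plaque_subset_leaf[OF c'] by blast
    qed
  qed
  fix y assume "y \<in> leaf B F x"
  then show "y \<in> leaf B F' x"
    unfolding leaf_def[of B F] mem_Collect_eq
  proof (induction rule: rtranclp_induct)
    case (step y z)
    then obtain c where "c \<in> F" "y \<in> chart_dom c" "z \<in> plaque B c y" by blast
    then have "z \<in> leaf B F' y" by (rule plaque)
    with step.IH show ?case by (rule leaf_trans)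
  qed (rule leaf_refl)
qed

lemma plaque_step_plaque:
  assumes "x \<in> chart_dom c"
  shows "plaque_step B c q x \<in> plaque B c x"
  using assms plaque_refl
  by (auto simp: plaque_step_def plaque_def coord_chart_inv chart_inv_dom slice_point_inner[OF B_Basis])

lemma plaque_step_leaf:
  assumes "c \<in> F"
  shows "plaque_step B c q x \<in> leaf B F x"
proof (cases "x \<in> chart_dom c")
  case True
  show ?thesis
    by (rule subsetD[OF plaque_subset_leaf[OF assms True] plaque_step_plaque[OF True]])
next
  case False
  then show ?thesis by (simp add: plaque_step_def leaf_refl)
qed

lemma walk_leaf: "set l \<subseteq> F \<times> UNIV \<Longrightarrow> walk B l x \<in> leaf B F x"
proof (induction l arbitrary: x)
  case (Cons cq l)
  obtain c q where cq: "cq = (c, q)" by (rule prod.exhaust)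
  then have "plaque_step B c q x \<in> leaf B F x"
    using Cons.prems by (intro plaque_step_leaf) simp
  moreover have "walk B l (plaque_step B c q x) \<in> leaf B F (plaque_step B c q x)"
    using Cons.prems by (intro Cons.IH) simp
  ultimately show ?case
    using leaf_trans unfolding cq by fastforce
qed (simp add: leaf_refl)

lemma walk_hits_plaque:
  assumes F': "F' \<subseteq> F"
    and Q: "\<And>X. open X \<Longrightarrow> X \<noteq> {} \<Longrightarrow> \<exists>q\<in>Q. q \<in> X"
    and "y \<in> leaf B F' x" and "c \<in> F'" and "y \<in> chart_dom c"
  shows "\<exists>l\<in>lists (F' \<times> Q). walk B l x \<in> plaque B c y"
  using assms(3-) unfolding leaf_def mem_Collect_eq
proof (induction arbitrary: c rule: rtranclp_induct)
  case base
  then show ?case by (intro bexI[of _ "[]"]) (simp_all add: plaque_refl)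
next
  case (step y z)
  then obtain c0 where c0: "c0 \<in> F'" "y \<in> chart_dom c0" "z \<in> plaque B c0 y" by blast
  then obtain l where l: "l \<in> lists (F' \<times> Q)" "walk B l x \<in> plaque B c0 y"
    using step.IH by blast
  let ?x = "walk B l x"
  have c0F: "c0 \<in> F" using F' c0(1) by (rule subsetD)
  have z: "z \<in> chart_dom c0" "?x \<in> plaque B c0 z"
    using plaque_dom[OF c0(3)] l(2) plaque_eq[OF c0(3)] by simp_all
  obtain W where W: "open W" "z \<in> W" "W \<subseteq> chart_dom c0 \<inter> chart_dom c"
      "\<And>y z. y \<in> W \<Longrightarrow> z \<in> W \<Longrightarrow> z \<in> plaque B c0 y \<Longrightarrow> z \<in> plaque B c y"
    using plaque_overlap[OF c0F subsetD[OF F' step.prems(1)] z(1) step.prems(2)] by metis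
  let ?Z = "coord c0 ` W"
  have "?Z = coord c0 ` chart_dom c0 \<inter> chart_inv c0 -` W"
    using coord_image_iff[OF c0F, of W] W(3) by blast
  then have "open ?Z"
    using continuous_open_preimage[OF continuous_chart_inv[OF c0F] open_image[OF c0F] W(1)] by simp
  then have "open ((\<lambda>q. slice_point B ((\<bullet>) q) (coord c0 z)) -` ?Z)"
    by (intro open_vimage continuous_slice_point continuous_intros)
  moreover have "coord c0 z \<in> (\<lambda>q. slice_point B ((\<bullet>) q) (coord c0 z)) -` ?Z"
    using W(2) by (simp add: slice_point_self[OF B_Basis])
  ultimately obtain q where q: "q \<in> Q" "slice_point B ((\<bullet>) q) (coord c0 z) \<in> ?Z"
    using Q by blast
  have same: "slice_point B ((\<bullet>) q) (coord c0 ?x) = slice_point B ((\<bullet>) q) (coord c0 z)"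
    using z(2) unfolding slice_point_def plaque_def by simp
  let ?y = "plaque_step B c0 q ?x"
  have "slice_point B ((\<bullet>) q) (coord c0 z) \<in> coord c0 ` chart_dom c0"
    and "chart_inv c0 (slice_point B ((\<bullet>) q) (coord c0 z)) \<in> W"
    using q(2) coord_image_iff[OF c0F, of W] W(3) by simp_all
  then have "?y \<in> W"
    using plaque_dom[OF z(2)] unfolding plaque_step_def same by simp
  moreover have "?y \<in> plaque B c0 z"
    using plaque_step_plaque[of ?x c0 q] plaque_dom[OF z(2)] plaque_eq[OF z(2)] by simp
  ultimately have "walk B (l @ [(c0, q)]) x \<in> plaque B c z"
    using W(2,4) by simp
  moreover have "l @ [(c0, q)] \<in> lists (F' \<times> Q)"
    using l(1) q(1) c0(1) by simp
  ultimately show ?case by (rule bexI)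
qed

section \<open>Measurability of leaf integrals\<close>

lemma dom_borel: "c \<in> F \<Longrightarrow> chart_dom c \<in> sets borel"
  and image_borel: "c \<in> F \<Longrightarrow> coord c ` chart_dom c \<in> sets borel"
  using open_dom open_image by (simp_all only: borel_open)

lemma measurable_coord:
  "c \<in> F \<Longrightarrow> (\<lambda>x. if x \<in> chart_dom c then coord c x else 0) \<in> borel_measurable borel"
  by (intro borel_measurable_continuous_on_if dom_borel continuous_coord continuous_intros)

lemma measurable_plaque_step:
  assumes "c \<in> F"
  shows "plaque_step B c q \<in> borel_measurable borel"
proof -
  define D where "D = chart_dom c \<inter> (\<lambda>x. slice_point B ((\<bullet>) q) (coord c x)) -` (coord c ` chart_dom c)"
  have cont: "continuous_on (chart_dom c) (\<lambda>x. slice_point B ((\<bullet>) q) (coord c x))"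
    by (intro continuous_slice_point continuous_coord[OF assms] continuous_intros)
  have "open D"
    unfolding D_def by (rule continuous_open_preimage[OF cont open_dom[OF assms] open_image[OF assms]])
  have "continuous_on D (\<lambda>x. chart_inv c (slice_point B ((\<bullet>) q) (coord c x)))"
    by (rule continuous_on_compose2[OF continuous_chart_inv[OF assms] continuous_on_subset[OF cont]])
      (auto simp: D_def)
  then have "(\<lambda>x. if x \<in> D then chart_inv c (slice_point B ((\<bullet>) q) (coord c x)) else x)
      \<in> borel_measurable borel"
    by (intro borel_measurable_continuous_on_if borel_open \<open>open D\<close> continuous_intros)
  then show ?thesis
    by (rule measurable_cong[THEN iffD1, rotated]) (simp add: plaque_step_def D_def)
qed

lemma measurable_walk: "set l \<subseteq> F \<times> UNIV \<Longrightarrow> walk B l \<in> borel_measurable borel"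
proof (induction l)
  case (Cons cq l)
  obtain c q where cq: "cq = (c, q)" by (rule prod.exhaust)
  have "c \<in> F" using Cons.prems cq by simp
  then have "(\<lambda>x. walk B l (plaque_step B c q x)) \<in> borel_measurable borel"
    using Cons by (intro measurable_compose[OF measurable_plaque_step]) simp_all
  then show ?case by (simp add: cq comp_def)
qed (simp add: id_def)

lemma pred_plaque:
  assumes "c \<in> F" and [measurable]: "u \<in> M \<rightarrow>\<^sub>M borel" "v \<in> M \<rightarrow>\<^sub>M borel"
  shows "Measurable.pred M (\<lambda>x. u x \<in> plaque B c (v x) \<and> v x \<in> chart_dom c)"
proof -
  note [measurable] = dom_borel[OF assms(1)] measurable_coord[OF assms(1)]
  have "Measurable.pred M (\<lambda>x. u x \<in> chart_dom c \<and> v x \<in> chart_dom c \<and>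
      (\<forall>b\<in>Basis - B. (if u x \<in> chart_dom c then coord c (u x) else 0) \<bullet> b =
         (if v x \<in> chart_dom c then coord c (v x) else 0) \<bullet> b))"
    using measurable_compose[OF assms(2) measurable_coord[OF assms(1)], measurable]
      measurable_compose[OF assms(3) measurable_coord[OF assms(1)], measurable]
    by measurable
  then show ?thesis
    by (rule measurable_cong[THEN iffD1, rotated]) (auto simp: plaque_def)
qed

lemma plaque_borel:
  assumes "c \<in> F" "x \<in> chart_dom c"
  shows "plaque B c x \<in> sets borel"
  using pred_plaque[OF assms(1), of "\<lambda>x. x" borel "\<lambda>_. x"] assms(2) by (simp add: pred_def)

definition chart_density :: "('m, 'e) chart \<Rightarrow> 'm set \<Rightarrow> 'e \<Rightarrow> ennreal" where
  "chart_density c S w = ennreal (sqrt (gram_det B (g c (chart_inv c w)))) * indicator (coord c ` S) w"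

lemma measurable_chart_density:
  assumes c: "c \<in> F" and S: "S \<in> sets borel" "S \<subseteq> chart_dom c"
  shows "chart_density c S \<in> borel_measurable borel"
proof -
  let ?I = "coord c ` chart_dom c"
  note [measurable] = image_borel[OF c]
  have "(\<lambda>w. g c (chart_inv c w) u v) \<in> borel_measurable (restrict_space borel ?I)" for u v
  proof (rule borel_measurable_continuous_on_restrict)
    have "smooth_on ?I (\<lambda>w. g c (chart_inv c w) u v)"
      using manifold c F_atlas unfolding riemannian_manifold_def riemannian_metric_def by blast
    then have "Ck_on 0 ?I (\<lambda>w. g c (chart_inv c w) u v)"
      unfolding smooth_on_def ..
    then show "continuous_on ?I (\<lambda>w. g c (chart_inv c w) u v)" by simp
  qed
  then have 1: "(\<lambda>w. ennreal (sqrt (gram_det B (g c (chart_inv c w)))))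
      \<in> borel_measurable (restrict_space borel ?I)"
    unfolding gram_det_def by measurable
  have "chart_inv c \<in> borel_measurable (restrict_space borel ?I)"
    by (intro borel_measurable_continuous_on_restrict continuous_chart_inv c)
  then have "chart_inv c -` S \<inter> space (restrict_space borel ?I) \<in> sets (restrict_space borel ?I)"
    using S(1) by (rule measurable_sets)
  also have "chart_inv c -` S \<inter> space (restrict_space borel ?I) = coord c ` S"
    using coord_image_iff[OF c S(2)] by (auto simp only: space_restrict_space space_borel)
  finally have im: "coord c ` S \<in> sets (restrict_space borel ?I)" .
  then have 2: "coord c ` S \<in> sets borel"
    using image_borel[OF c] by (simp add: sets_restrict_space_iff)
  have "(\<lambda>w. ennreal (sqrt (gram_det B (g c (chart_inv c w)))) * indicator ?I w)
      \<in> borel_measurable borel"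
    using 1 image_borel[OF c] by (simp add: borel_measurable_restrict_space_iff_ennreal)
  then have "(\<lambda>w. ennreal (sqrt (gram_det B (g c (chart_inv c w)))) * indicator ?I w
      * indicator (coord c ` S) w) \<in> borel_measurable borel"
    using 2 by measurable
  also have "(\<lambda>w. ennreal (sqrt (gram_det B (g c (chart_inv c w)))) * indicator ?I w
      * indicator (coord c ` S) w) = chart_density c S"
    using S(2) by (auto simp: chart_density_def fun_eq_iff split: split_indicator)
  finally show ?thesis .
qed

lemma measurable_slice_point:
  "(\<lambda>(z, u). slice_point B u z) \<in> borel_measurable (borel \<Otimes>\<^sub>M (\<Pi>\<^sub>M b\<in>B. lborel))"
proof -
  have [measurable]: "(\<lambda>x. snd x b) \<in> borel_measurable ((borel :: 'e measure) \<Otimes>\<^sub>M (\<Pi>\<^sub>M b\<in>B. lborel :: real measure))" if "b \<in> B" for b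
  proof -
    have "(\<lambda>x. snd x b) \<in> (borel :: 'e measure) \<Otimes>\<^sub>M (\<Pi>\<^sub>M b\<in>B. lborel) \<rightarrow>\<^sub>M (lborel :: real measure)"
      by (rule measurable_compose[OF measurable_snd measurable_component_singleton[OF that]])
    then show ?thesis by simp
  qed
  show ?thesis
    unfolding slice_point_def split_beta by measurable
qed

definition plaque_measure :: "('m, 'e) chart \<Rightarrow> 'm set \<Rightarrow> 'e \<Rightarrow> ennreal" where
  "plaque_measure c S z = (\<integral>\<^sup>+ u. chart_density c S (slice_point B u z) \<partial>(\<Pi>\<^sub>M b\<in>B. lborel))"

lemma measurable_plaque_measure:
  assumes "c \<in> F" "S \<in> sets borel" "S \<subseteq> chart_dom c"
  shows "plaque_measure c S \<in> borel_measurable borel"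
proof -
  interpret product_sigma_finite "\<lambda>_::'e. lborel :: real measure" ..
  interpret sigma_finite_measure "\<Pi>\<^sub>M b\<in>B. lborel :: real measure"
    by (rule sigma_finite[OF finite_B])
  show ?thesis
    unfolding plaque_measure_def
    by (rule borel_measurable_nn_integral)
      (use measurable_compose[OF measurable_slice_point measurable_chart_density[OF assms]]
        in \<open>simp add: split_beta'\<close>)
qed

lemma coord_volume_plaque:
  assumes c: "c \<in> F" and S: "S \<in> sets borel" "S \<subseteq> chart_dom c" and x: "x \<in> chart_dom c"
  shows "coord_volume g c B (coord c x) (S \<inter> plaque B c x) = plaque_measure c S (coord c x)"
proof -
  let ?z = "coord c x" and ?P = "\<Pi>\<^sub>M b\<in>B. lborel :: real measure"
  have SP: "S \<inter> plaque B c x \<in> sets borel" "S \<inter> plaque B c x \<subseteq> chart_dom c"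
    using S plaque_borel[OF c x] by auto
  have [measurable]: "(\<lambda>u. slice_point B u ?z) \<in> ?P \<rightarrow>\<^sub>M borel"
    using measurable_compose[OF measurable_Pair1' measurable_slice_point, of ?z] by simp
  have "coord_volume g c B ?z (S \<inter> plaque B c x)
      = (\<integral>\<^sup>+ w. chart_density c (S \<inter> plaque B c x) w \<partial>distr ?P borel (\<lambda>u. slice_point B u ?z))"
    unfolding coord_volume_def slice_lborel_def chart_density_def slice_point_def ..
  also have "\<dots> = (\<integral>\<^sup>+ u. chart_density c (S \<inter> plaque B c x) (slice_point B u ?z) \<partial>?P)"
    by (intro nn_integral_distr) (use measurable_chart_density[OF c SP] in simp_all)
  also have "\<dots> = plaque_measure c S ?z"
    unfolding plaque_measure_def
  proof (intro nn_integral_cong)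
    fix u
    let ?w = "slice_point B u ?z"
    have "?w \<bullet> b = ?z \<bullet> b" if "b \<in> Basis - B" for b
      using that by (simp add: slice_point_inner[OF B_Basis])
    then have "?w \<in> coord c ` (S \<inter> plaque B c x) \<longleftrightarrow> ?w \<in> coord c ` S"
      unfolding coord_image_iff[OF c SP(2)] coord_image_iff[OF c S(2)]
      using chart_inv_dom[of ?w c] coord_chart_inv[of ?w c]
      unfolding plaque_def by auto
    then show "chart_density c (S \<inter> plaque B c x) ?w = chart_density c S ?w"
      unfolding chart_density_def by (simp add: indicator_def)
  qed
  finally show ?thesis .
qed

lemma leaf_volumeD:
  assumes "leaf_volume g B F L \<nu>"
  shows "space \<nu> = L" and "S \<in> sets borel \<Longrightarrow> S \<inter> L \<in> sets \<nu>" and "complete_measure \<nu>"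
    and "\<lbrakk>c \<in> F; x \<in> chart_dom c; x \<in> L; plaque B c x \<subseteq> L; S \<in> sets borel; S \<subseteq> chart_dom c\<rbrakk> \<Longrightarrow>
      emeasure \<nu> (S \<inter> plaque B c x) = plaque_measure c S (coord c x)"
proof -
  obtain \<beta> where \<beta>: "\<nu> = completion \<beta>" "sets \<beta> = sets (restrict_space borel L)"
    "\<And>c x S. c \<in> F \<Longrightarrow> x \<in> chart_dom c \<inter> L \<Longrightarrow> S \<in> sets borel \<Longrightarrow> S \<subseteq> plaque B c x \<Longrightarrow>
       emeasure \<beta> S = coord_volume g c B (coord c x) S"
    using assms unfolding leaf_volume_def by blast
  have sets: "S \<inter> L \<in> sets \<beta>" if "S \<in> sets borel" for S
    using that unfolding \<beta>(2) sets_restrict_space by (auto simp: Int_commute)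
  show "space \<nu> = L"
    using sets_eq_imp_space_eq[OF \<beta>(2)] by (simp add: \<beta>(1) space_restrict_space)
  show "S \<inter> L \<in> sets \<nu>" if "S \<in> sets borel"
    using sets[OF that] by (simp add: \<beta>(1))
  show "complete_measure \<nu>" unfolding \<beta>(1) ..
  show "emeasure \<nu> (S \<inter> plaque B c x) = plaque_measure c S (coord c x)"
    if *: "c \<in> F" "x \<in> chart_dom c" "x \<in> L" "plaque B c x \<subseteq> L" "S \<in> sets borel" "S \<subseteq> chart_dom c"
  proof -
    have b: "S \<inter> plaque B c x \<in> sets borel"
      using *(5) plaque_borel[OF *(1,2)] by auto
    moreover have "S \<inter> plaque B c x \<inter> L = S \<inter> plaque B c x" using *(4) by auto
    ultimately have "S \<inter> plaque B c x \<in> sets \<beta>" using sets by metis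
    then have "emeasure \<nu> (S \<inter> plaque B c x) = emeasure \<beta> (S \<inter> plaque B c x)"
      by (simp add: \<beta>(1))
    also have "\<dots> = coord_volume g c B (coord c x) (S \<inter> plaque B c x)"
      using * b by (intro \<beta>(3)) auto
    also have "\<dots> = plaque_measure c S (coord c x)"
      by (rule coord_volume_plaque[OF *(1,5,6,2)])
    finally show "emeasure \<nu> (S \<inter> plaque B c x) = plaque_measure c S (coord c x)" .
  qed
qed

end

locale foliated_leaf_volumes = foliated_manifold A F g B
  for A F :: "('m::{second_countable_topology, t2_space}, 'e::euclidean_space) chart set"
    and g :: "('m, 'e) metric_coords"
    and B :: "'e set" +
  fixes \<nu> :: "'m set \<Rightarrow> 'm measure"
  assumes leaf_volumes: "L \<in> leaves B F \<Longrightarrow> leaf_volume g B F L (\<nu> L)"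
begin

lemma leaf_volume_at: "leaf_volume g B F (leaf B F x) (\<nu> (leaf B F x))"
  by (rule leaf_volumes) (simp add: leaves_def)

lemmas space_leaf_volume = leaf_volumeD(1)[OF leaf_volume_at]
  and sets_leaf_volume = leaf_volumeD(2)[OF leaf_volume_at]
  and complete_leaf_volume = leaf_volumeD(3)[OF leaf_volume_at]

lemma emeasure_leaf_plaque:
  assumes "c \<in> F" "y \<in> chart_dom c" "y \<in> leaf B F x" "S \<in> sets borel" "S \<subseteq> chart_dom c"
  shows "emeasure (\<nu> (leaf B F x)) (S \<inter> plaque B c y) = plaque_measure c S (coord c y)"
proof -
  have "plaque B c y \<subseteq> leaf B F x"
    using plaque_subset_leaf[OF assms(1,2), of B] leaf_eq[OF assms(3)] by simp
  then show ?thesis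
    using assms by (intro leaf_volumeD(4)[OF leaf_volume_at])
qed

lemma measurable_emeasure_leaf_chart:
  assumes F': "F' \<subseteq> F" "countable F'" "(\<Union>c\<in>F'. chart_dom c) = UNIV"
    and c: "c \<in> F'" and S: "S \<in> sets borel" "S \<subseteq> chart_dom c"
  shows "(\<lambda>x. emeasure (\<nu> (leaf B F x)) (S \<inter> leaf B F x)) \<in> borel_measurable borel"
proof -
  have cF: "c \<in> F" using F'(1) c by (rule subsetD)
  obtain Q :: "'e set" where Q: "countable Q" "\<And>X. open X \<Longrightarrow> X \<noteq> {} \<Longrightarrow> \<exists>q\<in>Q. q \<in> X"
    using countable_dense_exists[where 'a = 'e] by metis
  define h where "h n = walk B (from_nat_into (lists (F' \<times> Q)) n)" for n
  have "countable (lists (F' \<times> Q))" "lists (F' \<times> Q) \<noteq> {}"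
    using F'(2) Q(1) by (auto intro: countable_lists)
  then have range: "range (from_nat_into (lists (F' \<times> Q))) = lists (F' \<times> Q)"
    by (intro range_from_nat_into)
  then have "from_nat_into (lists (F' \<times> Q)) n \<in> lists (F' \<times> Q)" for n by blast
  then have set: "set (from_nat_into (lists (F' \<times> Q)) n) \<subseteq> F \<times> UNIV" for n
    using F'(1) by fastforce
  have h_leaf: "h n x \<in> leaf B F x" and [measurable]: "h n \<in> borel_measurable borel" for n x
    unfolding h_def by (rule walk_leaf[OF set], rule measurable_walk[OF set])
  have hits: "\<exists>n. h n x \<in> plaque B c y" if y: "y \<in> leaf B F x" "y \<in> chart_dom c" for x y
  proof -
    have "y \<in> leaf B F' x" using y(1) leaf_subatlas[OF F'(1,3)] by simp
    then have "\<exists>l\<in>lists (F' \<times> Q). walk B l x \<in> plaque B c y"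
      using c y(2) by (intro walk_hits_plaque[OF F'(1) Q(2)])
    then obtain l where l: "l \<in> lists (F' \<times> Q)" "walk B l x \<in> plaque B c y" ..
    then obtain n where "l = from_nat_into (lists (F' \<times> Q)) n" using range by (metis imageE)
    then show ?thesis using l(2) unfolding h_def by blast
  qed
  \<comment> \<open>Counts every plaque of the leaf once, at the first walk that reaches it.\<close>
  define new where "new n x \<longleftrightarrow> h n x \<in> chart_dom c \<and>
    (\<forall>m<n. \<not> (h n x \<in> plaque B c (h m x) \<and> h m x \<in> chart_dom c))" for n x
  have [measurable]: "Measurable.pred borel (new n)" for n
  proof -
    note [measurable] = dom_borel[OF cF]
    have [measurable]: "Measurable.pred borel (\<lambda>x. h n x \<in> plaque B c (h m x) \<and> h m x \<in> chart_dom c)" for m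
      by (rule pred_plaque[OF cF]) measurable
    show ?thesis unfolding new_def[abs_def] by measurable
  qed
  have "emeasure (\<nu> (leaf B F x)) (S \<inter> leaf B F x) =
      (\<Sum>n. if new n x then plaque_measure c S (if h n x \<in> chart_dom c then coord c (h n x) else 0) else 0)" for x
  proof -
    define P where "P n = (if new n x then S \<inter> plaque B c (h n x) else {})" for n
    have P_leaf: "P n \<subseteq> leaf B F x" for n
      using plaque_subset_leaf[OF cF, of "h n x" B] leaf_eq[OF h_leaf[of n x]]
      unfolding P_def new_def by auto
    have "P n \<in> sets borel" for n
      using S(1) plaque_borel[OF cF, of "h n x"] unfolding P_def new_def by auto
    then have "P n \<inter> leaf B F x \<in> sets (\<nu> (leaf B F x))" for n
      by (rule sets_leaf_volume)
    then have sets: "range P \<subseteq> sets (\<nu> (leaf B F x))"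
      using P_leaf by (auto simp: Int_absorb2)
    have disj: "P m \<inter> P n = {}" if "m < n" for m n
    proof (rule ccontr)
      assume "P m \<inter> P n \<noteq> {}"
      then obtain y where y: "y \<in> plaque B c (h m x)" "y \<in> plaque B c (h n x)" "new m x" "new n x"
        unfolding P_def by (auto split: if_splits)
      then have "plaque B c (h n x) = plaque B c (h m x)"
        using plaque_eq by metis
      then have "h n x \<in> plaque B c (h m x)"
        using plaque_refl[of "h n x" c B] y(4) unfolding new_def by simp
      then show False using y(3,4) that unfolding new_def by blast
    qed
    then have disj: "disjoint_family P"
      unfolding disjoint_family_on_def by (metis Int_commute nat_neq_iff)
    have "S \<inter> leaf B F x = (\<Union>n. P n)"
    proof (intro equalityI subsetI)
      fix y assume y: "y \<in> S \<inter> leaf B F x"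
      then have dom: "y \<in> chart_dom c" using S(2) by blast
      define n where "n = (LEAST n. h n x \<in> plaque B c y)"
      have hn: "h n x \<in> plaque B c y"
        unfolding n_def by (rule LeastI_ex) (use hits y dom in blast)
      have "new n x"
        unfolding new_def
      proof (intro conjI allI impI notI)
        show "h n x \<in> chart_dom c" using hn by (rule plaque_dom)
        fix m assume "m < n" and m: "h n x \<in> plaque B c (h m x) \<and> h m x \<in> chart_dom c"
        then have "h m x \<in> plaque B c y"
          using plaque_eq[OF hn] plaque_eq[of "h n x" B c "h m x"] plaque_refl[of "h m x" c B] by simp
        then show False using not_less_Least[of m] \<open>m < n\<close> unfolding n_def by blast
      qed
      moreover have "y \<in> plaque B c (h n x)"
        using plaque_eq[OF hn] plaque_refl[OF dom] by simp
      ultimately have "y \<in> P n" using y unfolding P_def by simp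
      then show "y \<in> (\<Union>n. P n)" by blast
    next
      fix y assume "y \<in> (\<Union>n. P n)"
      then obtain n where n: "y \<in> P n" by blast
      then have "y \<in> S" unfolding P_def by (simp split: if_splits)
      then show "y \<in> S \<inter> leaf B F x" using n P_leaf by blast
    qed
    then have "emeasure (\<nu> (leaf B F x)) (S \<inter> leaf B F x) = (\<Sum>n. emeasure (\<nu> (leaf B F x)) (P n))"
      using suminf_emeasure[OF sets disj] by simp
    also have "\<dots> = (\<Sum>n. if new n x then plaque_measure c S (if h n x \<in> chart_dom c then coord c (h n x) else 0) else 0)"
      by (intro suminf_cong) (auto simp: P_def new_def emeasure_leaf_plaque[OF cF _ h_leaf S])
    finally show ?thesis .
  qed
  moreover have "(\<lambda>x. \<Sum>n. if new n x then
      plaque_measure c S (if h n x \<in> chart_dom c then coord c (h n x) else 0) else 0) \<in> borel_measurable borel"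
  proof -
    note [measurable] = measurable_compose[OF measurable_compose[OF _ measurable_coord[OF cF]]
        measurable_plaque_measure[OF cF S]]
    show ?thesis by measurable
  qed
  ultimately show ?thesis by simp
qed

lemma measurable_emeasure_leaf:
  assumes S: "S \<in> sets borel"
  shows "(\<lambda>x. emeasure (\<nu> (leaf B F x)) (S \<inter> leaf B F x)) \<in> borel_measurable borel"
proof -
  obtain D where D: "D \<subseteq> chart_dom ` F" "countable D" "\<Union>D = \<Union>(chart_dom ` F)"
    by (rule Lindelof[of "chart_dom ` F"]) (use open_dom in auto)
  obtain F' where F': "F' \<subseteq> F" "countable F'" "D = chart_dom ` F'"
    using countable_subset_image[of D chart_dom F] D(1,2) by blast
  have cover: "(\<Union>c\<in>F'. chart_dom c) = UNIV" using D(3) F'(3) F_cover by simp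
  then have "F' \<noteq> {}" by auto
  define c where "c = from_nat_into F'"
  have range: "range c = F'"
    unfolding c_def using \<open>F' \<noteq> {}\<close> F'(2) by (rule range_from_nat_into)
  have cn: "c n \<in> F'" for n using range by blast
  define T where "T n = S \<inter> disjointed (\<lambda>n. chart_dom (c n)) n" for n
  have dom: "chart_dom (c n) \<in> sets borel" for n
    using F'(1) cn by (intro dom_borel) (rule subsetD)
  have T: "T n \<in> sets borel" for n
    using S sets.range_disjointed_sets[of "\<lambda>n. chart_dom (c n)" borel] dom
    unfolding T_def by blast
  have Tc: "T n \<subseteq> chart_dom (c n)" for n
    unfolding T_def using disjointed_subset[of "\<lambda>n. chart_dom (c n)" n] by blast
  have "(\<Union>n. chart_dom (c n)) = UNIV"
    using cover unfolding range[symmetric] by simp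
  then have "(\<Union>n. disjointed (\<lambda>n. chart_dom (c n)) n) = UNIV"
    unfolding UN_disjointed_eq .
  then have "(\<Union>n. T n) = S"
    unfolding T_def Int_UN_distrib[symmetric] by simp
  moreover have disj: "disjoint_family T"
    using disjoint_family_disjointed[of "\<lambda>n. chart_dom (c n)"]
    unfolding T_def disjoint_family_on_def by blast
  ultimately have "emeasure (\<nu> (leaf B F x)) (S \<inter> leaf B F x) =
      (\<Sum>n. emeasure (\<nu> (leaf B F x)) (T n \<inter> leaf B F x))" for x
  proof -
    have "disjoint_family (\<lambda>n. T n \<inter> leaf B F x)"
      using disj unfolding disjoint_family_on_def by blast
    moreover have "range (\<lambda>n. T n \<inter> leaf B F x) \<subseteq> sets (\<nu> (leaf B F x))"
      using sets_leaf_volume[OF T] by (rule image_subsetI)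
    moreover have "(\<Union>n. T n \<inter> leaf B F x) = S \<inter> leaf B F x"
      unfolding \<open>(\<Union>n. T n) = S\<close>[symmetric] by simp
    ultimately show ?thesis
      using suminf_emeasure[of "\<lambda>n. T n \<inter> leaf B F x" "\<nu> (leaf B F x)"] by simp
  qed
  moreover have "(\<lambda>x. \<Sum>n. emeasure (\<nu> (leaf B F x)) (T n \<inter> leaf B F x)) \<in> borel_measurable borel"
    by (intro borel_measurable_suminf_order measurable_emeasure_leaf_chart[OF F'(1,2) cover cn T Tc])
  ultimately show ?thesis by simp
qed

lemma measurable_leaf_volume:
  assumes "f \<in> borel \<rightarrow>\<^sub>M N"
  shows "f \<in> \<nu> (leaf B F x) \<rightarrow>\<^sub>M N"
proof (rule measurableI)
  show "f y \<in> space N" for y using measurable_space[OF assms] by simp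
  fix S assume "S \<in> sets N"
  then have "f -` S \<in> sets borel" using measurable_sets[OF assms] by simp
  then show "f -` S \<inter> space (\<nu> (leaf B F x)) \<in> sets (\<nu> (leaf B F x))"
    unfolding space_leaf_volume by (rule sets_leaf_volume)
qed

lemma measurable_nn_integral_leaf:
  assumes "f \<in> borel_measurable borel"
  shows "(\<lambda>x. \<integral>\<^sup>+ y. f y \<partial>\<nu> (leaf B F x)) \<in> borel_measurable borel"
  using assms
proof induction
  case (set S)
  have "(\<integral>\<^sup>+ y. indicator S y \<partial>\<nu> (leaf B F x)) = emeasure (\<nu> (leaf B F x)) (S \<inter> leaf B F x)" for x
    using sets_leaf_volume[OF set, of x]
    by (simp add: nn_integral_indicator' space_leaf_volume)
  then show ?case using measurable_emeasure_leaf[OF set] by simp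
next
  case (cong f h)
  then have "f = h" by auto
  then show ?case using cong by simp
next
  case (mult u c)
  then show ?case
    by (subst nn_integral_cmult) (auto intro: measurable_leaf_volume)
next
  case (add u v)
  then show ?case
    by (subst nn_integral_add) (auto intro: measurable_leaf_volume)
next
  case (seq U)
  have "(\<integral>\<^sup>+ y. (SUP i. U i) y \<partial>\<nu> (leaf B F x)) = (SUP i. \<integral>\<^sup>+ y. U i y \<partial>\<nu> (leaf B F x))" for x
    unfolding SUP_apply
    by (rule nn_integral_monotone_convergence_SUP[OF seq(3) measurable_leaf_volume[OF seq(1)]])
  then show ?case using seq by simp
qed

end

section \<open>The first variation of the modulus\<close>

lemma (in complete_measure) borel_measurable_AE_eq:
  fixes f h :: "'a \<Rightarrow> real"
  assumes f: "f \<in> borel_measurable M" and eq: "AE x in M. f x = h x"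
  shows "h \<in> borel_measurable M"
proof (rule measurableI)
  fix S :: "real set" assume "S \<in> sets borel"
  then have sets: "f -` S \<inter> space M \<in> sets M" by (rule measurable_sets[OF f])
  have "AE x in M. x \<in> f -` S \<inter> space M \<longleftrightarrow> x \<in> h -` S \<inter> space M"
    using eq by eventually_elim simp
  then show "h -` S \<inter> space M \<in> sets M" by (rule in_sets_AE[OF _ sets]) auto
qed simp

lemma powr_tangent_le:
  fixes a b p :: real
  assumes "p > 1" "a > 0" "b > 0"
  shows "a powr p - b powr p \<le> p * a powr (p - 1) * (a - b)"
proof -
  have q: "p / (p - 1) > 1" "1 / p + 1 / (p / (p - 1)) = 1"
    using assms(1) by (simp_all add: field_simps)
  have "b * a powr (p - 1) \<le> b powr p / p + (a powr (p - 1)) powr (p / (p - 1)) / (p / (p - 1))"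
    by (rule Youngs_inequality) (use assms q in auto)
  also have "(a powr (p - 1)) powr (p / (p - 1)) = a powr p"
    using assms by (simp add: powr_powr)
  finally have "p * (b * a powr (p - 1)) \<le> p * (b powr p / p + a powr p / (p / (p - 1)))"
    using assms(1) by (intro mult_left_mono) auto
  also have "\<dots> = b powr p + (p - 1) * a powr p"
    using assms(1) by (simp add: field_simps)
  finally have "p * (b * a powr (p - 1)) \<le> b powr p + (p - 1) * a powr p" .
  moreover have "a powr (p - 1) * a = a powr p"
    using assms(2) by (simp add: powr_mult_base[of a "p - 1"] mult.commute)
  ultimately show ?thesis by (simp add: algebra_simps)
qed

lemma nn_integral_add_integrable_ge:
  fixes f \<psi> :: "'a \<Rightarrow> real"
  assumes [measurable]: "f \<in> borel_measurable M" and nonneg: "AE x in M. 0 \<le> f x"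
    and \<psi>: "integrable M \<psi>" and ge: "ennreal a \<le> (\<integral>\<^sup>+ x. ennreal (f x) \<partial>M)" "a \<ge> 0"
  shows "ennreal (a + (\<integral>x. \<psi> x \<partial>M)) \<le> (\<integral>\<^sup>+ x. ennreal (f x + \<psi> x) \<partial>M)"
proof -
  note [measurable] = borel_measurable_integrable[OF \<psi>]
  let ?P = "\<integral>\<^sup>+ x. ennreal (\<psi> x) \<partial>M" and ?N = "\<integral>\<^sup>+ x. ennreal (- \<psi> x) \<partial>M"
  let ?X = "\<integral>\<^sup>+ x. ennreal (f x + \<psi> x) \<partial>M"
  have "?P < top" "?N < top"
    using \<psi> unfolding real_integrable_def by (simp_all add: less_top)
  then obtain u v where u: "?P = ennreal u" "u \<ge> 0" and v: "?N = ennreal v" "v \<ge> 0"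
    by (metis ennreal_cases less_irrefl)
  then have int: "(\<integral>x. \<psi> x \<partial>M) = u - v"
    using real_lebesgue_integral_def[OF \<psi>] by simp
  have pt: "ennreal (f x) + ennreal (\<psi> x) \<le> ennreal (f x + \<psi> x) + ennreal (- \<psi> x)" if "0 \<le> f x" for x
  proof (cases "\<psi> x \<ge> 0")
    case True
    then show ?thesis using that by (simp add: ennreal_neg)
  next
    case False
    then have "ennreal (f x) \<le> ennreal (max 0 (f x + \<psi> x) + - \<psi> x)"
      by (intro ennreal_leI) simp
    also have "\<dots> = ennreal (max 0 (f x + \<psi> x)) + ennreal (- \<psi> x)"
      using False by (intro ennreal_plus) auto
    also have "ennreal (max 0 (f x + \<psi> x)) = ennreal (f x + \<psi> x)"
      by (simp add: max_def ennreal_neg)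
    finally show ?thesis using False by (simp add: ennreal_neg)
  qed
  have "ennreal a + ?P \<le> (\<integral>\<^sup>+ x. ennreal (f x) + ennreal (\<psi> x) \<partial>M)"
    using ge(1) by (subst nn_integral_add) (auto intro: add_right_mono)
  also have "\<dots> \<le> (\<integral>\<^sup>+ x. ennreal (f x + \<psi> x) + ennreal (- \<psi> x) \<partial>M)"
  proof (rule nn_integral_mono_AE)
    show "AE x in M. ennreal (f x) + ennreal (\<psi> x) \<le> ennreal (f x + \<psi> x) + ennreal (- \<psi> x)"
      using nonneg by eventually_elim (rule pt)
  qed
  also have "\<dots> = ?X + ?N" by (intro nn_integral_add) measurable
  finally have le: "ennreal a + ?P \<le> ?X + ?N" .
  show ?thesis
  proof (cases "?X")
    case (real x)
    then have "ennreal (a + u) \<le> ennreal (x + v)"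
      using le u v ge(2) by simp
    then have "a + u \<le> x + v" using real(1) v(2) by (subst (asm) ennreal_le_iff) auto
    then show ?thesis unfolding real(2) int by (intro ennreal_leI) simp
  qed simp
qed

locale leafwise_measure =
  fixes \<mu> :: "'m::topological_space measure"
    and lf :: "'m \<Rightarrow> 'm set"
    and \<nu> :: "'m set \<Rightarrow> 'm measure"
  assumes volume: "\<exists>\<beta>. \<mu> = completion \<beta> \<and> sets \<beta> = sets borel"
    and mem_lf: "x \<in> lf x"
    and lf_eq: "y \<in> lf x \<Longrightarrow> lf y = lf x"
    and space_lf: "space (\<nu> (lf x)) = lf x"
    and complete_lf: "complete_measure (\<nu> (lf x))"
    and measurable_lf: "f \<in> borel_measurable borel \<Longrightarrow> (f :: 'm \<Rightarrow> real) \<in> borel_measurable (\<nu> (lf x))"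
    and measurable_nn_integral_lf: "h \<in> borel_measurable borel \<Longrightarrow>
      (\<lambda>x. \<integral>\<^sup>+ y. h y \<partial>\<nu> (lf x)) \<in> borel_measurable borel"
begin

lemma space_\<mu>: "space \<mu> = UNIV"
proof -
  obtain \<beta> where "\<mu> = completion \<beta>" "sets \<beta> = sets borel" using volume by blast
  then show ?thesis using sets_eq_imp_space_eq[of \<beta> borel] by simp
qed

lemma measurable_\<mu>: "f \<in> borel \<rightarrow>\<^sub>M N \<Longrightarrow> f \<in> \<mu> \<rightarrow>\<^sub>M N"
proof -
  obtain \<beta> where "\<mu> = completion \<beta>" "sets \<beta> = sets borel" using volume by blast
  then show "f \<in> borel \<rightarrow>\<^sub>M N \<Longrightarrow> f \<in> \<mu> \<rightarrow>\<^sub>M N"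
    using measurable_completion measurable_cong_sets by blast
qed

lemma borel_sets_\<mu>: "S \<in> sets borel \<Longrightarrow> S \<in> sets \<mu>"
proof -
  obtain \<beta> where "\<mu> = completion \<beta>" "sets \<beta> = sets borel" using volume by blast
  then show "S \<in> sets borel \<Longrightarrow> S \<in> sets \<mu>" by simp
qed

sublocale complete_measure \<mu>
proof -
  obtain \<beta> where "\<mu> = completion \<beta>" using volume by blast
  then show "complete_measure \<mu>" by (simp add: completion.complete_measure_axioms)
qed

lemma borel_representative:
  fixes f :: "'m \<Rightarrow> real"
  assumes "f \<in> borel_measurable \<mu>"
  obtains f' where "f' \<in> borel_measurable borel" "AE x in \<mu>. f x = f' x"
proof -
  obtain \<beta> where \<beta>: "\<mu> = completion \<beta>" "sets \<beta> = sets borel" using volume by blast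
  obtain f' where "f' \<in> borel_measurable \<beta>" "AE x in \<beta>. f x = f' x"
    using completion_ex_borel_measurable_real[of f \<beta>] assms \<beta> by blast
  then show ?thesis
    using that AE_completion \<beta> measurable_cong_sets by blast
qed

lemma almost_every_leaf_iff: "almost_every_leaf \<mu> (range lf) P \<longleftrightarrow> (AE x in \<mu>. P (lf x))"
proof -
  have "\<Union>{L \<in> range lf. \<not> P L} = {x \<in> space \<mu>. \<not> P (lf x)}"
    using mem_lf lf_eq unfolding space_\<mu> by fastforce
  then show ?thesis
    unfolding almost_every_leaf_def AE_iff_null_sets by simp
qed

end

locale extremal_leafwise = leafwise_measure \<mu> lf \<nu>
  for \<mu> :: "'m::topological_space measure" and lf :: "'m \<Rightarrow> 'm set" and \<nu> :: "'m set \<Rightarrow> 'm measure"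
  + fixes p :: real and f0 :: "'m \<Rightarrow> real" and c :: real
  assumes p: "p > 1"
    and extremal_f0: "extremal p \<mu> (range lf) \<nu> f0"
    and c_pos: "c > 0"
    and f0_ge: "AE x in \<mu>. c \<le> f0 x"
begin

lemma f0_adm: "f0 \<in> adm p \<mu> (range lf) \<nu>"
  using extremal_f0 by (simp add: extremal_def)

lemma measurable_f0[measurable]: "f0 \<in> borel_measurable \<mu>"
  and integrable_f0: "integrable \<mu> (\<lambda>x. \<bar>f0 x\<bar> powr p)"
  and f0_leaf: "AE x in \<mu>. f0 \<in> borel_measurable (\<nu> (lf x)) \<and> 1 \<le> (\<integral>\<^sup>+ y. ennreal (f0 y) \<partial>\<nu> (lf x))"
  using f0_adm unfolding adm_def Lp_def almost_every_leaf_iff by simp_all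

lemma f0_minimal:
  assumes "f \<in> adm p \<mu> (range lf) \<nu>"
  shows "(\<integral>x. \<bar>f0 x\<bar> powr p \<partial>\<mu>) \<le> (\<integral>x. \<bar>f x\<bar> powr p \<partial>\<mu>)" (is "?a \<le> ?b")
proof -
  have "modulus p \<mu> (range lf) \<nu> \<le> ennreal (Lp_norm p \<mu> f)"
    unfolding modulus_def using assms by (rule INF_lower)
  then have "ennreal (Lp_norm p \<mu> f0) \<le> ennreal (Lp_norm p \<mu> f)"
    using extremal_f0 by (simp add: extremal_def)
  then have "?a powr (1 / p) \<le> ?b powr (1 / p)"
    unfolding Lp_norm_def by simp
  moreover have "?a \<ge> 0" "?b \<ge> 0" by simp_all
  ultimately show ?thesis
    using powr_less_mono2[of "1 / p" ?b ?a] p by force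
qed

lemma null_saturated:
  assumes E: "E \<in> sets borel" and sat: "\<And>x y. y \<in> lf x \<Longrightarrow> y \<in> E \<longleftrightarrow> x \<in> E"
    and u: "\<And>\<epsilon>. \<epsilon> > 0 \<Longrightarrow> \<exists>u. u \<in> borel_measurable borel \<and> (\<forall>x. 0 \<le> u x) \<and>
      integrable \<mu> (\<lambda>x. u x powr p) \<and> (\<integral>x. u x powr p \<partial>\<mu>) \<le> \<epsilon> \<and>
      (\<forall>x\<in>E. 1 \<le> (\<integral>\<^sup>+ y. ennreal (u y) \<partial>\<nu> (lf x)))"
  shows "AE x in \<mu>. x \<notin> E"
proof -
  have [measurable]: "E \<in> sets \<mu>" using E by (rule borel_sets_\<mu>)
  have int: "integrable \<mu> (\<lambda>x. indicator E x * \<bar>f0 x\<bar> powr p)"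
      "integrable \<mu> (\<lambda>x. indicator (- E) x * \<bar>f0 x\<bar> powr p)"
    using integrable_real_mult_indicator[OF _ integrable_f0, of E]
      integrable_real_mult_indicator[OF _ integrable_f0, of "- E"]
      \<open>E \<in> sets \<mu>\<close> sets.compl_sets[of E \<mu>] space_\<mu> by (simp_all add: mult.commute Compl_eq_Diff_UNIV)
  have le: "(\<integral>x. indicator E x * \<bar>f0 x\<bar> powr p \<partial>\<mu>) \<le> \<epsilon>" if eps: "\<epsilon> > 0" for \<epsilon>
  proof -
    obtain u where u: "u \<in> borel_measurable borel" "\<And>x. 0 \<le> u x" "integrable \<mu> (\<lambda>x. u x powr p)"
      "(\<integral>x. u x powr p \<partial>\<mu>) \<le> \<epsilon>" "\<And>x. x \<in> E \<Longrightarrow> 1 \<le> (\<integral>\<^sup>+ y. ennreal (u y) \<partial>\<nu> (lf x))"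
      using assms(3)[OF eps] by blast
    note [measurable] = measurable_\<mu>[OF u(1)]
    define f where "f x = (if x \<in> E then u x else f0 x)" for x
    have f_powr: "\<bar>f x\<bar> powr p = indicator E x * u x powr p + indicator (- E) x * \<bar>f0 x\<bar> powr p" for x
      using u(2) by (simp add: f_def split: split_indicator)
    have intu: "integrable \<mu> (\<lambda>x. indicator E x * u x powr p)"
      using integrable_real_mult_indicator[OF _ u(3), of E] by (simp add: mult.commute)
    have "f \<in> adm p \<mu> (range lf) \<nu>"
      unfolding adm_def Lp_def almost_every_leaf_iff mem_Collect_eq
    proof (intro conjI)
      show "f \<in> borel_measurable \<mu>" unfolding f_def[abs_def] by measurable
      show "integrable \<mu> (\<lambda>x. \<bar>f x\<bar> powr p)"
        unfolding f_powr using intu int(2) by (rule Bochner_Integration.integrable_add)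
      show "AE x in \<mu>. 0 \<le> f x"
        using f0_ge by eventually_elim (use u(2) c_pos in \<open>simp add: f_def\<close>)
      show "AE x in \<mu>. f \<in> borel_measurable (\<nu> (lf x)) \<and> 1 \<le> (\<integral>\<^sup>+ y. ennreal (f y) \<partial>\<nu> (lf x))"
        using f0_leaf
      proof eventually_elim
        case (elim x)
        define w where "w = (if x \<in> E then u else f0)"
        have fw: "f y = w y" if "y \<in> space (\<nu> (lf x))" for y
          using sat[of y x] that unfolding space_lf f_def w_def by simp
        have "f \<in> borel_measurable (\<nu> (lf x)) \<longleftrightarrow> w \<in> borel_measurable (\<nu> (lf x))"
          and "(\<integral>\<^sup>+ y. ennreal (f y) \<partial>\<nu> (lf x)) = (\<integral>\<^sup>+ y. ennreal (w y) \<partial>\<nu> (lf x))"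
          by (rule measurable_cong, erule fw) (rule nn_integral_cong, simp only: fw)
        moreover have "w \<in> borel_measurable (\<nu> (lf x)) \<and> 1 \<le> (\<integral>\<^sup>+ y. ennreal (w y) \<partial>\<nu> (lf x))"
          using elim u(5) measurable_lf[OF u(1)] unfolding w_def by simp
        ultimately show ?case by simp
      qed
    qed
    then have "(\<integral>x. \<bar>f0 x\<bar> powr p \<partial>\<mu>) \<le> (\<integral>x. \<bar>f x\<bar> powr p \<partial>\<mu>)"
      by (rule f0_minimal)
    also have "\<dots> = (\<integral>x. indicator E x * u x powr p \<partial>\<mu>) + (\<integral>x. indicator (- E) x * \<bar>f0 x\<bar> powr p \<partial>\<mu>)"
      unfolding f_powr using intu int(2) by (rule Bochner_Integration.integral_add)
    also have "(\<integral>x. indicator E x * u x powr p \<partial>\<mu>) \<le> (\<integral>x. u x powr p \<partial>\<mu>)"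
      by (rule integral_mono[OF intu u(3)]) (simp split: split_indicator)
    also have "(\<integral>x. u x powr p \<partial>\<mu>) \<le> \<epsilon>" by (rule u(4))
    also have "(\<integral>x. \<bar>f0 x\<bar> powr p \<partial>\<mu>) = (\<integral>x. indicator E x * \<bar>f0 x\<bar> powr p + indicator (- E) x * \<bar>f0 x\<bar> powr p \<partial>\<mu>)"
      by (rule Bochner_Integration.integral_cong) (simp_all split: split_indicator)
    also have "\<dots> = (\<integral>x. indicator E x * \<bar>f0 x\<bar> powr p \<partial>\<mu>) + (\<integral>x. indicator (- E) x * \<bar>f0 x\<bar> powr p \<partial>\<mu>)"
      using int by (rule Bochner_Integration.integral_add)
    finally show ?thesis by simp
  qed
  have "(\<integral>x. indicator E x * \<bar>f0 x\<bar> powr p \<partial>\<mu>) \<le> 0"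
    by (rule field_le_epsilon) (simp only: add_0_left le)
  moreover have "(\<integral>x. indicator E x * \<bar>f0 x\<bar> powr p \<partial>\<mu>) \<ge> 0" by simp
  ultimately have "(\<integral>x. indicator E x * \<bar>f0 x\<bar> powr p \<partial>\<mu>) = 0" by simp
  then have "AE x in \<mu>. indicator E x * \<bar>f0 x\<bar> powr p = 0"
    using integral_nonneg_eq_0_iff_AE[OF int(1)] by simp
  then show ?thesis
    using f0_ge by eventually_elim (use c_pos in \<open>auto split: split_indicator_asm\<close>)
qed

lemma AE_leaf_AE:
  assumes "AE x in \<mu>. P x"
  shows "AE x in \<mu>. AE y in \<nu> (lf x). P y"
proof -
  obtain \<beta> where \<beta>: "\<mu> = completion \<beta>" "sets \<beta> = sets borel" using volume by blast
  have "AE x in \<beta>. P x" using assms unfolding \<beta>(1) AE_completion_iff .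
  then obtain N where N: "{x \<in> space \<beta>. \<not> P x} \<subseteq> N" "emeasure \<beta> N = 0" "N \<in> sets \<beta>"
    by (rule AE_E)
  have [measurable]: "N \<in> sets borel" using N(3) \<beta>(2) by simp
  have "N \<in> null_sets \<mu>"
    unfolding \<beta>(1) using N by (intro null_sets_completionI null_setsI)
  then have N_AE: "AE x in \<mu>. x \<notin> N" by (rule AE_not_in)
  define I where "I x = (\<integral>\<^sup>+ y. indicator N y \<partial>\<nu> (lf x))" for x
  have [measurable]: "I \<in> borel_measurable borel"
    unfolding I_def[abs_def] by (rule measurable_nn_integral_lf) measurable
  have ind: "(indicator N :: 'm \<Rightarrow> real) \<in> borel_measurable (\<nu> (lf x))" for x
    by (rule measurable_lf) measurable
  have ind': "(indicator N :: 'm \<Rightarrow> ennreal) \<in> borel_measurable (\<nu> (lf x))" for x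
    using measurable_compose[OF ind[of x] measurable_ennreal] by (simp add: ennreal_indicator)
  have I_mult: "(\<integral>\<^sup>+ y. ennreal (real k * indicator N y) \<partial>\<nu> (lf x)) = of_nat k * I x" for k x
    unfolding I_def using nn_integral_cmult[OF ind'[of x], of "of_nat k"]
    by (simp add: ennreal_mult ennreal_of_nat_eq_real_of_nat ennreal_indicator)
  have "AE x in \<mu>. x \<notin> {x. 1 \<le> of_nat k * I x}" for k
  proof (rule null_saturated)
    show "{x. 1 \<le> of_nat k * I x} \<in> sets borel" by measurable
    show "y \<in> {x. 1 \<le> of_nat k * I x} \<longleftrightarrow> x \<in> {x. 1 \<le> of_nat k * I x}" if "y \<in> lf x" for x y
      using lf_eq[OF that] by (simp add: I_def)
    have *: "AE x in \<mu>. (real k * indicator N x) powr p = 0"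
      using N_AE by eventually_elim simp
    note [measurable] = borel_sets_\<mu>[OF \<open>N \<in> sets borel\<close>]
    have m: "(\<lambda>x. (real k * indicator N x) powr p) \<in> borel_measurable \<mu>" by measurable
    have "(\<integral>x. (real k * indicator N x) powr p \<partial>\<mu>) = (\<integral>x. 0 \<partial>\<mu>)"
      by (rule integral_cong_AE[OF m _ *]) simp
    moreover have "integrable \<mu> (\<lambda>x. (real k * indicator N x) powr p)"
    proof (rule integrable_cong_AE_imp[OF _ m])
      show "AE x in \<mu>. 0 = (real k * indicator N x) powr p" using * by eventually_elim simp
    qed simp
    ultimately show "\<exists>u. u \<in> borel_measurable borel \<and> (\<forall>x. 0 \<le> u x) \<and>
      integrable \<mu> (\<lambda>x. u x powr p) \<and> (\<integral>x. u x powr p \<partial>\<mu>) \<le> \<epsilon> \<and>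
      (\<forall>x\<in>{x. 1 \<le> of_nat k * I x}. 1 \<le> (\<integral>\<^sup>+ y. ennreal (u y) \<partial>\<nu> (lf x)))" if "\<epsilon> > 0" for \<epsilon>
      using that by (intro exI[of _ "\<lambda>x. real k * indicator N x"]) (simp add: I_mult)
  qed
  then have "AE x in \<mu>. \<forall>k. x \<notin> {x. 1 \<le> of_nat k * I x}" by (simp add: AE_all_countable)
  then show ?thesis
  proof eventually_elim
    case (elim x)
    have "I x = 0"
    proof (rule ccontr)
      assume "I x \<noteq> 0"
      show False
      proof (cases "I x = top")
        case True
        then show False using elim[rule_format, of 1] by simp
      next
        case False
        then obtain r where r: "I x = ennreal r" "r \<ge> 0" by (cases "I x") auto
        then have "r > 0" using \<open>I x \<noteq> 0\<close> by (cases "r = 0") auto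
        obtain k where "1 / r < real k" using reals_Archimedean2 by blast
        then have "1 \<le> real k * r" using \<open>r > 0\<close> by (simp add: field_simps)
        moreover have "of_nat k * I x = ennreal (real k * r)"
          using r(2) by (simp add: r(1) ennreal_mult ennreal_of_nat_eq_real_of_nat)
        ultimately have "1 \<le> of_nat k * I x" by simp
        then show False using elim by blast
      qed
    qed
    then have "AE y in \<nu> (lf x). indicator N y = (0 :: ennreal)"
      unfolding I_def using ind' by (simp add: nn_integral_0_iff_AE)
    then show ?case
      by eventually_elim
        (use N(1) sets_eq_imp_space_eq[OF \<beta>(2)] in \<open>auto simp: indicator_eq_0_iff\<close>)
  qed
qed

lemma
  assumes "\<phi> \<in> Lp p \<mu>"
  shows AE_leaf_integrable: "AE x in \<mu>. integrable (\<nu> (lf x)) \<phi>"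
    and measurable_leaf_integral: "(\<lambda>x. \<integral>y. \<phi> y \<partial>\<nu> (lf x)) \<in> borel_measurable \<mu>"
proof -
  have \<phi>[measurable]: "\<phi> \<in> borel_measurable \<mu>" and int: "integrable \<mu> (\<lambda>x. \<bar>\<phi> x\<bar> powr p)"
    using assms by (simp_all add: Lp_def)
  obtain \<psi> where \<psi>[measurable]: "\<psi> \<in> borel_measurable borel" and eq: "AE x in \<mu>. \<phi> x = \<psi> x"
    using \<phi> by (rule borel_representative)
  note [measurable] = measurable_\<mu>[OF \<psi>] measurable_lf[OF \<psi>]
  have int\<psi>: "integrable \<mu> (\<lambda>x. \<bar>\<psi> x\<bar> powr p)"
  proof (rule integrable_cong_AE_imp[OF int])
    show "AE x in \<mu>. \<bar>\<phi> x\<bar> powr p = \<bar>\<psi> x\<bar> powr p" using eq by eventually_elim simp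
  qed measurable
  define I where "I x = (\<integral>\<^sup>+ y. ennreal \<bar>\<psi> y\<bar> \<partial>\<nu> (lf x))" for x
  have [measurable]: "I \<in> borel_measurable borel"
    unfolding I_def[abs_def] by (rule measurable_nn_integral_lf) measurable
  have "AE x in \<mu>. x \<notin> {x. I x = top}"
  proof (rule null_saturated)
    show "{x. I x = top} \<in> sets borel" by measurable
    show "y \<in> {x. I x = top} \<longleftrightarrow> x \<in> {x. I x = top}" if "y \<in> lf x" for x y
      using lf_eq[OF that] by (simp add: I_def)
    fix \<epsilon> :: real assume "\<epsilon> > 0"
    define J where "J = (\<integral>x. \<bar>\<psi> x\<bar> powr p \<partial>\<mu>)"
    have "J \<ge> 0" unfolding J_def by simp
    define \<delta> where "\<delta> = (\<epsilon> / (J + 1)) powr (1 / p)"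
    have "\<delta> > 0" using \<open>\<epsilon> > 0\<close> \<open>J \<ge> 0\<close> by (simp add: \<delta>_def)
    have "\<delta> powr p = \<epsilon> / (J + 1)"
      using p \<open>\<epsilon> > 0\<close> \<open>J \<ge> 0\<close> by (simp add: \<delta>_def powr_powr)
    then have "\<delta> powr p * (J + 1) = \<epsilon>" using \<open>J \<ge> 0\<close> by simp
    moreover have "\<delta> powr p * J \<le> \<delta> powr p * (J + 1)" by (intro mult_left_mono) auto
    ultimately have "\<delta> powr p * J \<le> \<epsilon>" by simp
    moreover have "(\<delta> * \<bar>\<psi> x\<bar>) powr p = \<delta> powr p * \<bar>\<psi> x\<bar> powr p" for x
      using \<open>\<delta> > 0\<close> by (simp add: powr_mult)
    moreover have "(\<integral>\<^sup>+ y. ennreal (\<delta> * \<bar>\<psi> y\<bar>) \<partial>\<nu> (lf x)) = ennreal \<delta> * I x" for x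
      unfolding I_def using \<open>\<delta> > 0\<close>
      by (subst nn_integral_cmult[symmetric]) (auto simp: ennreal_mult)
    ultimately show "\<exists>u. u \<in> borel_measurable borel \<and> (\<forall>x. 0 \<le> u x) \<and>
      integrable \<mu> (\<lambda>x. u x powr p) \<and> (\<integral>x. u x powr p \<partial>\<mu>) \<le> \<epsilon> \<and>
      (\<forall>x\<in>{x. I x = top}. 1 \<le> (\<integral>\<^sup>+ y. ennreal (u y) \<partial>\<nu> (lf x)))"
      using int\<psi> \<open>\<delta> > 0\<close>
      by (intro exI[of _ "\<lambda>x. \<delta> * \<bar>\<psi> x\<bar>"]) (auto simp: J_def ennreal_mult_top)
  qed
  moreover have "AE x in \<mu>. AE y in \<nu> (lf x). \<phi> y = \<psi> y"
    using eq by (rule AE_leaf_AE)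
  ultimately have main: "AE x in \<mu>. integrable (\<nu> (lf x)) \<phi> \<and>
    (\<integral>y. \<phi> y \<partial>\<nu> (lf x)) = enn2real (\<integral>\<^sup>+ y. ennreal (\<psi> y) \<partial>\<nu> (lf x)) - enn2real (\<integral>\<^sup>+ y. ennreal (- \<psi> y) \<partial>\<nu> (lf x))"
  proof eventually_elim
    case (elim x)
    interpret leaf: complete_measure "\<nu> (lf x)" by (rule complete_lf)
    have eq': "AE y in \<nu> (lf x). \<psi> y = \<phi> y" using elim(2) by eventually_elim simp
    have [measurable]: "\<phi> \<in> borel_measurable (\<nu> (lf x))"
      by (rule leaf.borel_measurable_AE_eq[OF measurable_lf[OF \<psi>] eq'])
    have "integrable (\<nu> (lf x)) \<psi>"
      using elim(1) unfolding I_def by (intro integrableI_bounded) (auto simp: less_top)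
    then have "integrable (\<nu> (lf x)) \<phi>" and "(\<integral>y. \<phi> y \<partial>\<nu> (lf x)) = (\<integral>y. \<psi> y \<partial>\<nu> (lf x))"
      using elim(2) eq' by (auto intro: integrable_cong_AE_imp integral_cong_AE)
    then show ?case
      using real_lebesgue_integral_def[OF \<open>integrable (\<nu> (lf x)) \<psi>\<close>] by simp
  qed
  then show "AE x in \<mu>. integrable (\<nu> (lf x)) \<phi>" by eventually_elim simp
  have "(\<lambda>x. enn2real (\<integral>\<^sup>+ y. ennreal (\<psi> y) \<partial>\<nu> (lf x)) - enn2real (\<integral>\<^sup>+ y. ennreal (- \<psi> y) \<partial>\<nu> (lf x)))
      \<in> borel_measurable \<mu>"
    by (intro measurable_\<mu> borel_measurable_diff borel_measurable_enn2real measurable_nn_integral_lf) measurable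
  then show "(\<lambda>x. \<integral>y. \<phi> y \<partial>\<nu> (lf x)) \<in> borel_measurable \<mu>"
    by (rule borel_measurable_AE_eq) (use main in \<open>eventually_elim, simp\<close>)
qed

lemma integrable_f0_powr: "integrable \<mu> (\<lambda>x. f0 x powr p)"
proof (rule integrable_cong_AE_imp[OF integrable_f0])
  show "AE x in \<mu>. \<bar>f0 x\<bar> powr p = f0 x powr p"
    using f0_ge by eventually_elim (use c_pos in simp)
qed measurable

lemma
  fixes \<phi> :: "'m \<Rightarrow> real" and C t :: real
  defines "h \<equiv> \<lambda>x. \<integral>y. \<phi> y \<partial>\<nu> (lf x)"
  defines "f \<equiv> \<lambda>x. (f0 x + t * \<phi> x) / (1 + t * h x)"
  assumes \<phi>: "\<phi> \<in> Lp p \<mu>" and bounds: "AE x in \<mu>. \<bar>\<phi> x\<bar> \<le> C" "AE x in \<mu>. \<bar>h x\<bar> \<le> C"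
    and t: "t > 0" "t * C \<le> 1 / 2" "t * C \<le> c / 2"
  shows perturbation_bounds: "AE x in \<mu>. f0 x / 3 \<le> f x \<and> f x \<le> 3 * f0 x"
    and perturbation_adm: "f \<in> adm p \<mu> (range lf) \<nu>"
proof -
  have [measurable]: "\<phi> \<in> borel_measurable \<mu>" "h \<in> borel_measurable \<mu>"
    using \<phi> measurable_leaf_integral[OF \<phi>] by (simp_all add: Lp_def h_def)
  have [measurable]: "f \<in> borel_measurable \<mu>" unfolding f_def by measurable
  have bt: "\<bar>t * u\<bar> \<le> t * C" if "\<bar>u\<bar> \<le> C" for u
    using that t(1) by (simp add: abs_mult)
  show f: "AE x in \<mu>. f0 x / 3 \<le> f x \<and> f x \<le> 3 * f0 x"
    using f0_ge bounds
  proof eventually_elim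
    case (elim x)
    let ?n = "f0 x + t * \<phi> x" and ?d = "1 + t * h x"
    have n: "f0 x / 2 \<le> ?n" "?n \<le> 3 * f0 x / 2" and d: "1 / 2 \<le> ?d" "?d \<le> 3 / 2"
      using bt[OF elim(2)] bt[OF elim(3)] t elim(1) by linarith+
    have "f0 x > 0" using elim(1) c_pos by simp
    then have "f0 x / 3 * ?d \<le> f0 x / 3 * (3 / 2)" "3 * f0 x * (1 / 2) \<le> 3 * f0 x * ?d"
      using d by (auto intro!: mult_left_mono)
    then show ?case
      using n d unfolding f_def by (simp add: pos_le_divide_eq pos_divide_le_eq)
  qed
  have int: "integrable \<mu> (\<lambda>x. \<bar>f x\<bar> powr p)"
  proof (rule Bochner_Integration.integrable_bound)
    show "integrable \<mu> (\<lambda>x. 3 powr p * f0 x powr p)"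
      by (intro integrable_mult_right integrable_f0_powr)
    show "AE x in \<mu>. norm (\<bar>f x\<bar> powr p) \<le> norm (3 powr p * f0 x powr p)"
      using f f0_ge
    proof eventually_elim
      case (elim x)
      then have "f x \<ge> 0" "f0 x > 0" using c_pos by linarith+
      then have "\<bar>f x\<bar> powr p \<le> (3 * f0 x) powr p"
        using elim p by (intro powr_mono2) auto
      then show ?case using \<open>f0 x > 0\<close> by (simp add: powr_mult)
    qed
  qed measurable
  have "AE x in \<mu>. f \<in> borel_measurable (\<nu> (lf x)) \<and> 1 \<le> (\<integral>\<^sup>+ y. ennreal (f y) \<partial>\<nu> (lf x))"
    using f0_leaf AE_leaf_integrable[OF \<phi>] AE_leaf_AE[OF f0_ge] bounds(2)
  proof eventually_elim
    case (elim x)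
    let ?M = "\<nu> (lf x)" and ?d = "1 + t * h x"
    have [measurable]: "f0 \<in> borel_measurable ?M" "\<phi> \<in> borel_measurable ?M"
      using elim by auto
    have d: "?d > 0" using bt[OF elim(4)] t by linarith
    have f_eq: "f y = (f0 y + t * \<phi> y) / ?d" if "y \<in> space ?M" for y
      using that lf_eq[of y x] unfolding f_def h_def space_lf by simp
    have "f \<in> borel_measurable ?M \<longleftrightarrow> (\<lambda>y. (f0 y + t * \<phi> y) / ?d) \<in> borel_measurable ?M"
      by (rule measurable_cong) (rule f_eq)
    then have meas: "f \<in> borel_measurable ?M" by simp
    have "AE y in ?M. 0 \<le> f0 y" using elim(3) by eventually_elim (use c_pos in simp)
    then have "ennreal (1 + (\<integral>y. t * \<phi> y \<partial>?M)) \<le> (\<integral>\<^sup>+ y. ennreal (f0 y + t * \<phi> y) \<partial>?M)"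
      using elim(1,2) by (intro nn_integral_add_integrable_ge) auto
    then have X: "ennreal ?d \<le> (\<integral>\<^sup>+ y. ennreal (f0 y + t * \<phi> y) \<partial>?M)"
      by (simp add: h_def)
    have "(\<integral>\<^sup>+ y. ennreal (f y) \<partial>?M) = (\<integral>\<^sup>+ y. ennreal (1 / ?d) * ennreal (f0 y + t * \<phi> y) \<partial>?M)"
      using d by (intro nn_integral_cong) (simp add: f_eq ennreal_mult'[symmetric])
    also have "\<dots> = ennreal (1 / ?d) * (\<integral>\<^sup>+ y. ennreal (f0 y + t * \<phi> y) \<partial>?M)"
      by (rule nn_integral_cmult) measurable
    also have "\<dots> \<ge> ennreal (1 / ?d) * ennreal ?d"
      using X by (rule mult_left_mono) simp
    also have "ennreal (1 / ?d) * ennreal ?d = 1"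
      using d by (subst ennreal_mult[symmetric]) auto
    finally show ?case using meas by simp
  qed
  moreover have "AE x in \<mu>. 0 \<le> f x"
    using f f0_ge by eventually_elim (use c_pos in linarith)
  ultimately show "f \<in> adm p \<mu> (range lf) \<nu>"
    using int unfolding adm_def Lp_def almost_every_leaf_iff by simp
qed

lemma first_variation_nonneg:
  fixes \<phi> :: "'m \<Rightarrow> real" and C :: real
  defines "h \<equiv> \<lambda>x. \<integral>y. \<phi> y \<partial>\<nu> (lf x)"
  assumes \<phi>: "\<phi> \<in> Lp p \<mu>" and bounds: "AE x in \<mu>. \<bar>\<phi> x\<bar> \<le> C" "AE x in \<mu>. \<bar>h x\<bar> \<le> C"
  shows "0 \<le> (\<integral>x. f0 x powr (p - 1) * (\<phi> x - f0 x * h x) \<partial>\<mu>)"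
proof -
  define K where "K = max C 1"
  have K: "K \<ge> 1" "AE x in \<mu>. \<bar>\<phi> x\<bar> \<le> K" "AE x in \<mu>. \<bar>h x\<bar> \<le> K"
    using bounds by (auto simp: K_def)
  have [measurable]: "\<phi> \<in> borel_measurable \<mu>" "h \<in> borel_measurable \<mu>"
    using \<phi> measurable_leaf_integral[OF \<phi>] by (simp_all add: Lp_def h_def)
  define t where "t n = min 1 c / (2 * K) / real (Suc n)" for n
  have t_pos: "t n > 0" for n using K(1) c_pos by (simp add: t_def)
  have tK: "t n * K \<le> 1 / 2" "t n * K \<le> c / 2" for n
  proof -
    have "t n * K = min 1 c / 2 / real (Suc n)" using K(1) by (simp add: t_def)
    also have "\<dots> \<le> min 1 c / 2 / 1" using c_pos by (intro divide_left_mono) auto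
    finally show "t n * K \<le> 1 / 2" "t n * K \<le> c / 2" by auto
  qed
  have t_lim: "t \<longlonglongrightarrow> 0"
    unfolding t_def[abs_def] by (rule lim_const_over_n[THEN LIMSEQ_Suc])
  define f where "f n x = (f0 x + t n * \<phi> x) / (1 + t n * h x)" for n x
  define w where "w n x = f n x powr (p - 1) * ((\<phi> x - f0 x * h x) / (1 + t n * h x))" for n x
  have [measurable]: "f n \<in> borel_measurable \<mu>" "w n \<in> borel_measurable \<mu>" for n
    unfolding w_def[abs_def] f_def[abs_def] by measurable
  have f_bounds: "AE x in \<mu>. f0 x / 3 \<le> f n x \<and> f n x \<le> 3 * f0 x"
    and f_adm: "f n \<in> adm p \<mu> (range lf) \<nu>" for n
    using perturbation_bounds[OF \<phi> K(2) _ t_pos tK, of n] perturbation_adm[OF \<phi> K(2) _ t_pos tK, of n] K(3)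
    unfolding f_def[abs_def] h_def by simp_all
  define D where "D = 2 * K * (1 / c + 1) * 3 powr (p - 1)"
  have int_D: "integrable \<mu> (\<lambda>x. D * f0 x powr p)"
    by (intro integrable_mult_right integrable_f0_powr)
  have w_bound: "AE x in \<mu>. norm (w n x) \<le> D * f0 x powr p" for n
    using f_bounds[of n] f0_ge K(2,3)
  proof eventually_elim
    case (elim x)
    have f0: "f0 x > 0" using elim c_pos by linarith
    have "\<bar>t n * h x\<bar> \<le> t n * K" using elim(4) t_pos[of n] by (simp add: abs_mult)
    then have d: "1 + t n * h x \<ge> 1 / 2" using tK(1)[of n] by linarith
    have "\<bar>\<phi> x - f0 x * h x\<bar> \<le> \<bar>\<phi> x\<bar> + \<bar>f0 x * h x\<bar>" by (rule abs_triangle_ineq4)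
    also have "\<dots> \<le> K + f0 x * K"
      using elim f0 by (intro add_mono) (auto simp: abs_mult)
    also have "\<dots> \<le> f0 x / c * K + f0 x * K"
      using elim(2) c_pos K(1) by (intro add_right_mono) (simp add: field_simps)
    also have "\<dots> = K * (1 / c + 1) * f0 x" by (simp add: algebra_simps)
    finally have "\<bar>\<phi> x - f0 x * h x\<bar> / \<bar>1 + t n * h x\<bar> \<le> K * (1 / c + 1) * f0 x / (1 / 2)"
      using d by (intro frac_le) auto
    also have "\<dots> = 2 * K * (1 / c + 1) * f0 x" by simp
    finally have 1: "\<bar>(\<phi> x - f0 x * h x) / (1 + t n * h x)\<bar> \<le> 2 * K * (1 / c + 1) * f0 x"
      unfolding abs_divide .
    have "f n x powr (p - 1) \<le> (3 * f0 x) powr (p - 1)"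
      using elim f0 p by (intro powr_mono2) auto
    then have 2: "f n x powr (p - 1) \<le> 3 powr (p - 1) * f0 x powr (p - 1)"
      using f0 by (simp add: powr_mult)
    have "norm (w n x) = f n x powr (p - 1) * \<bar>(\<phi> x - f0 x * h x) / (1 + t n * h x)\<bar>"
      by (simp add: w_def abs_mult)
    also have "\<dots> \<le> (3 powr (p - 1) * f0 x powr (p - 1)) * (2 * K * (1 / c + 1) * f0 x)"
      using 1 2 by (intro mult_mono) auto
    also have "\<dots> = D * (f0 x * f0 x powr (p - 1))" by (simp add: D_def)
    also have "f0 x * f0 x powr (p - 1) = f0 x powr p"
      using f0 by (simp add: powr_mult_base)
    finally show ?case .
  qed
  have int_w: "integrable \<mu> (w n)" for n
  proof (rule Bochner_Integration.integrable_bound[OF int_D])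
    show "AE x in \<mu>. norm (w n x) \<le> norm (D * f0 x powr p)"
      using w_bound[of n] by eventually_elim simp
  qed measurable
  have w_nonneg: "0 \<le> (\<integral>x. w n x \<partial>\<mu>)" for n
  proof -
    have int_f: "integrable \<mu> (\<lambda>x. \<bar>f n x\<bar> powr p)"
      using f_adm[of n] by (simp add: adm_def Lp_def)
    have "0 \<le> (\<integral>x. \<bar>f n x\<bar> powr p \<partial>\<mu>) - (\<integral>x. \<bar>f0 x\<bar> powr p \<partial>\<mu>)"
      using f0_minimal[OF f_adm] by simp
    also have "\<dots> = (\<integral>x. \<bar>f n x\<bar> powr p - \<bar>f0 x\<bar> powr p \<partial>\<mu>)"
      using int_f integrable_f0 by simp
    also have "\<dots> \<le> (\<integral>x. p * t n * w n x \<partial>\<mu>)"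
    proof (rule integral_mono_AE)
      show "AE x in \<mu>. \<bar>f n x\<bar> powr p - \<bar>f0 x\<bar> powr p \<le> p * t n * w n x"
        using f_bounds[of n] f0_ge K(3)
      proof eventually_elim
        case (elim x)
        have pos: "f0 x > 0" "f n x > 0" using elim c_pos by linarith+
        have "\<bar>t n * h x\<bar> \<le> t n * K" using elim(3) t_pos[of n] by (simp add: abs_mult)
        then have d: "1 + t n * h x > 0" using tK(1)[of n] by linarith
        have "\<bar>f n x\<bar> powr p - \<bar>f0 x\<bar> powr p \<le> p * f n x powr (p - 1) * (f n x - f0 x)"
          using powr_tangent_le[OF p pos(2,1)] pos by simp
        also have "f n x - f0 x = t n * ((\<phi> x - f0 x * h x) / (1 + t n * h x))"
          using d unfolding f_def by (simp add: field_simps)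
        finally show ?case by (simp add: w_def mult_ac)
      qed
    qed (use int_f integrable_f0 int_w in auto)
    also have "\<dots> = p * t n * (\<integral>x. w n x \<partial>\<mu>)" by simp
    finally have "0 \<le> p * t n * (\<integral>x. w n x \<partial>\<mu>)" .
    moreover have "p * t n > 0" using p t_pos[of n] by simp
    ultimately show ?thesis by (metis linorder_not_less mult_pos_neg)
  qed
  have "(\<lambda>n. \<integral>x. w n x \<partial>\<mu>) \<longlonglongrightarrow> (\<integral>x. f0 x powr (p - 1) * (\<phi> x - f0 x * h x) \<partial>\<mu>)"
  proof (rule integral_dominated_convergence[OF _ _ int_D])
    show "AE x in \<mu>. (\<lambda>n. w n x) \<longlonglongrightarrow> f0 x powr (p - 1) * (\<phi> x - f0 x * h x)"
      using f0_ge
    proof eventually_elim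
      case (elim x)
      have "(\<lambda>n. f n x) \<longlonglongrightarrow> (f0 x + 0 * \<phi> x) / (1 + 0 * h x)"
        unfolding f_def by (intro tendsto_intros t_lim) simp
      then have "(\<lambda>n. w n x) \<longlonglongrightarrow> f0 x powr (p - 1) * ((\<phi> x - f0 x * h x) / (1 + 0 * h x))"
        unfolding w_def using elim c_pos by (intro tendsto_intros t_lim) auto
      then show ?case by simp
    qed
  qed (use w_bound in measurable)
  then show ?thesis by (rule LIMSEQ_le_const) (use w_nonneg in blast)
qed

lemma euler_lagrange:
  fixes \<phi> :: "'m \<Rightarrow> real" and C :: real
  defines "h \<equiv> \<lambda>x. \<integral>y. \<phi> y \<partial>\<nu> (lf x)"
  assumes \<phi>: "\<phi> \<in> Lp p \<mu>" and bounds: "AE x in \<mu>. \<bar>\<phi> x\<bar> \<le> C" "AE x in \<mu>. \<bar>h x\<bar> \<le> C"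
  shows "(\<integral>x. f0 x powr (p - 1) * \<phi> x \<partial>\<mu>) = (\<integral>x. f0 x powr p * h x \<partial>\<mu>)"
proof -
  have [measurable]: "\<phi> \<in> borel_measurable \<mu>" "h \<in> borel_measurable \<mu>"
    using \<phi> measurable_leaf_integral[OF \<phi>] by (simp_all add: Lp_def h_def)
  have h_neg: "(\<integral>y. - \<phi> y \<partial>\<nu> (lf x)) = - h x" for x by (simp add: h_def)
  have "(\<lambda>x. - \<phi> x) \<in> Lp p \<mu>" using \<phi> by (simp add: Lp_def)
  then have "0 \<le> (\<integral>x. f0 x powr (p - 1) * (- \<phi> x - f0 x * - h x) \<partial>\<mu>)"
    using first_variation_nonneg[of "\<lambda>x. - \<phi> x" C] bounds unfolding h_neg by simp
  also have "\<dots> = (\<integral>x. - (f0 x powr (p - 1) * (\<phi> x - f0 x * h x)) \<partial>\<mu>)"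
    by (intro Bochner_Integration.integral_cong) (simp_all add: algebra_simps)
  finally have "(\<integral>x. f0 x powr (p - 1) * (\<phi> x - f0 x * h x) \<partial>\<mu>) = 0"
    using first_variation_nonneg[OF \<phi>, of C] bounds unfolding h_def by simp
  also have "(\<integral>x. f0 x powr (p - 1) * (\<phi> x - f0 x * h x) \<partial>\<mu>)
      = (\<integral>x. f0 x powr (p - 1) * \<phi> x - f0 x powr p * h x \<partial>\<mu>)"
  proof (rule integral_cong_AE)
    show "AE x in \<mu>. f0 x powr (p - 1) * (\<phi> x - f0 x * h x) = f0 x powr (p - 1) * \<phi> x - f0 x powr p * h x"
      using f0_ge
    proof eventually_elim
      case (elim x)
      then have "f0 x powr p = f0 x * f0 x powr (p - 1)"
        using c_pos by (simp add: powr_mult_base)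
      then show ?case by (simp add: algebra_simps)
    qed
  qed measurable
  also have "\<dots> = (\<integral>x. f0 x powr (p - 1) * \<phi> x \<partial>\<mu>) - (\<integral>x. f0 x powr p * h x \<partial>\<mu>)"
  proof (rule Bochner_Integration.integral_diff)
    show "integrable \<mu> (\<lambda>x. f0 x powr (p - 1) * \<phi> x)"
    proof (rule Bochner_Integration.integrable_bound)
      show "integrable \<mu> (\<lambda>x. C / c * f0 x powr p)"
        by (intro integrable_mult_right integrable_f0_powr)
      show "AE x in \<mu>. norm (f0 x powr (p - 1) * \<phi> x) \<le> norm (C / c * f0 x powr p)"
        using f0_ge bounds(1)
      proof eventually_elim
        case (elim x)
        have "\<bar>\<phi> x\<bar> \<le> C * 1" using elim by simp
        also have "\<dots> \<le> C * (f0 x / c)" using elim c_pos by (intro mult_left_mono) auto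
        finally have "f0 x powr (p - 1) * \<bar>\<phi> x\<bar> \<le> f0 x powr (p - 1) * (C * (f0 x / c))"
          by (rule mult_left_mono) simp
        also have "\<dots> = C / c * (f0 x * f0 x powr (p - 1))" by simp
        also have "f0 x * f0 x powr (p - 1) = f0 x powr p"
          using elim c_pos by (simp add: powr_mult_base)
        finally show ?case using c_pos elim(2) by (simp add: abs_mult)
      qed
    qed measurable
    show "integrable \<mu> (\<lambda>x. f0 x powr p * h x)"
    proof (rule Bochner_Integration.integrable_bound)
      show "integrable \<mu> (\<lambda>x. C * f0 x powr p)"
        by (intro integrable_mult_right integrable_f0_powr)
      show "AE x in \<mu>. norm (f0 x powr p * h x) \<le> norm (C * f0 x powr p)"
        using bounds(2) by eventually_elim (auto simp: abs_mult mult.commute intro!: mult_right_mono)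
    qed measurable
  qed
  finally show ?thesis by simp
qed

end

lemma ess_sup_abs_boundedE:
  assumes "ess_sup M (\<lambda>x. ereal \<bar>f x\<bar>) < \<infinity>"
  obtains C where "AE x in M. \<bar>f x\<bar> \<le> C"
proof -
  obtain C where "ess_sup M (\<lambda>x. ereal \<bar>f x\<bar>) < ereal C"
    using ereal_dense2[OF assms] by blast
  then have "eventually (\<lambda>x. ereal \<bar>f x\<bar> < ereal C) (ae_filter M)"
    unfolding ess_sup_def by (rule Limsup_le_iff[THEN iffD1, OF order_refl, rule_format])
  then have "AE x in M. \<bar>f x\<bar> \<le> C" by eventually_elim simp
  then show ?thesis by (rule that)
qed

lemma ess_inf_posE:
  assumes "ess_inf M (\<lambda>x. ereal (f x)) > 0"
  obtains c where "c > 0" "AE x in M. c \<le> f x"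
proof -
  obtain c where c: "0 < ereal c" "ereal c < ess_inf M (\<lambda>x. ereal (f x))"
    using ereal_dense2[OF assms] by blast
  have "eventually (\<lambda>x. ereal c < ereal (f x)) (ae_filter M)"
    using c(2) unfolding ess_inf_def by (rule le_Liminf_iff[THEN iffD1, OF order_refl, rule_format])
  then have "AE x in M. c \<le> f x" by eventually_elim simp
  moreover have "c > 0" using c(1) by simp
  ultimately show ?thesis using that by blast
qed

theorem theorem4p2:
  fixes A F :: "('m::{second_countable_topology, t2_space}, 'e::euclidean_space) chart set"
    and g :: "('m, 'e) metric_coords"
    and B :: "'e set"
    and \<mu> :: "'m measure"
    and \<nu> :: "'m set \<Rightarrow> 'm measure"
    and p :: real
    and f\<^sub>0 \<phi> :: "'m \<Rightarrow> real"
  assumes "riemannian_manifold A g"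
    and "foliated_atlas A B F"
    and "riemannian_volume A g \<mu>"
    and "\<And>L. L \<in> leaves B F \<Longrightarrow> leaf_volume g B F L (\<nu> L)"
    and "p > 1"
    and "extremal p \<mu> (leaves B F) \<nu> f\<^sub>0"
    and "ess_inf \<mu> (\<lambda>x. ereal (f\<^sub>0 x)) > 0"
    and "\<phi> \<in> Lp p \<mu>"
    and "ess_sup \<mu> (\<lambda>x. ereal \<bar>\<phi> x\<bar>) < \<infinity>"
    and "ess_sup \<mu> (\<lambda>x. ereal \<bar>leaf_integral B F \<nu> \<phi> x\<bar>) < \<infinity>"
  shows "(\<integral>x. f\<^sub>0 x powr (p - 1) * \<phi> x \<partial>\<mu>) = (\<integral>x. f\<^sub>0 x powr p * leaf_integral B F \<nu> \<phi> x \<partial>\<mu>)"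
proof -
  interpret foliated_leaf_volumes A F g B \<nu>
    using assms(1,2,4) by unfold_locales
  obtain c where c: "c > 0" "AE x in \<mu>. c \<le> f\<^sub>0 x"
    using assms(7) by (rule ess_inf_posE)
  interpret leafwise_measure \<mu> "leaf B F" \<nu>
  proof (rule leafwise_measure.intro)
    show "\<exists>\<beta>. \<mu> = completion \<beta> \<and> sets \<beta> = sets borel"
      using assms(3) unfolding riemannian_volume_def by blast
  qed (fact leaf_refl leaf_eq space_leaf_volume complete_leaf_volume measurable_leaf_volume
      measurable_nn_integral_leaf)+
  interpret extremal_leafwise \<mu> "leaf B F" \<nu> p f\<^sub>0 c
  proof
    show "extremal p \<mu> (range (leaf B F)) \<nu> f\<^sub>0"
      using assms(6) unfolding leaves_def .
  qed (fact assms(5) c)+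
  obtain C where C: "AE x in \<mu>. \<bar>\<phi> x\<bar> \<le> C"
    using assms(9) by (rule ess_sup_abs_boundedE)
  obtain C' where C': "AE x in \<mu>. \<bar>\<integral>y. \<phi> y \<partial>\<nu> (leaf B F x)\<bar> \<le> C'"
    using assms(10) unfolding leaf_integral_def by (rule ess_sup_abs_boundedE)
  have "AE x in \<mu>. \<bar>\<phi> x\<bar> \<le> max C C'" "AE x in \<mu>. \<bar>\<integral>y. \<phi> y \<partial>\<nu> (leaf B F x)\<bar> \<le> max C C'"
    using C C' by (eventually_elim, simp)+
  then show ?thesis
    unfolding leaf_integral_def by (rule euler_lagrange[OF assms(8)])
qed

end
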